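(* Let $(\mathrm{C},\otimes,e)$ be a small strict complete continuous symmetric monoidal category, and let $\mathrm{mor}(\mathrm{C})$ be the set of all arrows of $\mathrm{C}$. Then: (i) There is a $(\mathsf{scpx}_{\neq\emptyset},\{\circ_k\})$-algebra structure on $\mathrm{mor}(\mathrm{C})$ given by the maps $\overrightarrow{\mathcal{L}}_n\colon\mathsf{scpx}_{\neq\emptyset}(n)\times\mathrm{mor}(\mathrm{C})^n\to\mathrm{mor}(\mathrm{C})$, $$\overrightarrow{\mathcal{L}}_n(K;\underline{f})=\Bigl(\lim_{I\in\mathrm{cat}(K)^{\mathrm{op}}}z_n(I;\underline{f})\to z_n([n];\underline{f})\Bigr),$$ the canonical morphism from the limit of $z_n(-;\underline{f})\colon\mathrm{cat}(K)^{\mathrm{op}}\to\mathrm{C}$ to $z_n([n];\underline{f})=\bigotimes_{j=1}^nX_j$. (ii) There is a $(\mathsf{scpx}_{\neq\emptyset},\{\circ_k^c\})$-algebra structure on $\mathrm{mor}(\mathrm{C})$ given by the maps $\overrightarrow{\mathcal{L}}_n^c\colon\mathsf{scpx}_{\neq\emptyset}(n)\times\mathrm{mor}(\mathrm{C})^n\to\mathrm{mor}(\mathrm{C})$, $$\overrightarrow{\mathcal{L}}_n^c(K;\underline{f})=\Bigl(z_n(\emptyset;\underline{f})\to\lim_{I\in\mathrm{cat}(K)^{\mathrm{op}}}z_n(I;\underline{f})\Bigr),$$ the canonical morphism from $z_n(\emptyset;\underline{f})=\bigotimes_{j=1}^nY_j$ to the limit of $z_n(-;\underline{f})\colon\mathrm{cat}(K)^{\mathrm{op}}\to\mathrm{C}$.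 Here $n\ge1$ and $\underline{f}=(f_j\colon Y_j\to X_j)_{j\in[n]}$.
   Context: Simplicial complexes: for $n\ge1$, $[n]=\{1,\dots,n\}$, $\mathsf{scpx}_{\neq\emptyset}(n)$ is the set of non-empty families $K$ of subsets of $[n]$ closed under taking subsets (so $\emptyset\in K$; ghost vertices allowed), with $\mathbb{S}_n$ acting by relabelling. For $I\subseteq[n]$ put $I^{<k}=\{i\in I\mid i<k\}$, $I^{>k}=\{i\in I\mid i>k\}$, $I+\ell=\{i+\ell\mid i\in I\}$. For $I\subseteq[n]$, $J\subseteq[m]$, $k\in[n]$: $I\circ_kJ=I^{<k}\sqcup(J+k-1)\sqcup(I^{>k}+m-1)$ if $k\in I$, and $I^{<k}\sqcup(I^{>k}+m-1)$ if $k\notin I$; $I\circ_k^cJ=I^{<k}\sqcup([m]+k-1)\sqcup(I^{>k}+m-1)$ if $k\in I$, and $I^{<k}\sqcup(J+k-1)\sqcup(I^{>k}+m-1)$ if $k\notin I$. The substitution operad has $K\circ_kL=\{I\circ_kJ\mid I\in K,J\in L\}$ with unit $\{\emptyset,\{1\}\}$ on $[1]$. The composition operad has $K\circ_k^cL$ equal to the set of all subsets of the sets $I\circ_k^cJ$, $I\in K$, $J\in L$, with unit $\{\emptyset\}$ on $[1]$. $\mathrm{cat}(K)$ is the poset $K$ ordered by inclusion, regarded as a category. Its opposite $\mathrm{cat}(K)^{\mathrm{op}}$ is identified, by taking complements in $[n]$, with the poset $\{[n]\setminus F\mid F\in K\}$ ordered by inclusion. The functor $z_n(-;\underline{f})\colon\mathrm{cat}(K)^{\mathrm{op}}\to\mathrm{C}$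 is the restriction of the cubical functor below to this poset; thus in the limits the index $I$ ranges over the complements $[n]\setminus F$ of faces $F$ of $K$. Cubical functor: for $\underline{f}=(f_i\colon Y_i\to X_i)_{i\in[n]}$ arrows of $\mathrm{C}$, $z_n(-;\underline{f})\colon(\wp([n]),\subseteq)\to\mathrm{C}$ (with $\wp([n])$ the power set of $[n]$) is given by $z_n(I;\underline{f})=\bigotimes_{i=1}^nZ_i^I$ with $Z_i^I=X_i$ if $i\in I$ and $Z_i^I=Y_i$ if $i\notin I$; on $I\subseteq J$ it is $\bigotimes_i\phi_i$ with $\phi_i=\mathrm{id}_{X_i}$ if $i\in I$, $\phi_i=f_i$ if $i\in J\setminus I$, $\phi_i=\mathrm{id}_{Y_i}$ if $i\notin J$. "Continuous" means that $\otimes$ preserves limits in each variable. An algebra over a set operad $\mathcal{O}$ on a set $X$ is a morphism of operads from $\mathcal{O}$ to the endomorphism operad of $X$ (with $\mathrm{End}_X(n)=\mathrm{Hom}(X^n,X)$), i.e. maps $\mathcal{O}(n)\times X^n\to X$ compatible with units, symmetric group actions and compositions.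
   Formalization: "Strict" here also requires the symmetry to be the identity (equivariance forces X₁⊗X₂=X₂⊗X₁, which fails for the indiscrete category on a non-commutative monoid), and the limits are suitably chosen representatives, since the algebra laws are equalities of arrows. *)

theory Defs
  imports Main "HOL-Library.FuncSet" "HOL-Combinatorics.Permutations"
begin

section \<open>Small categories, functors and limits\<close>

record ('o, 'm) category =
  Obj :: "'o set"
  Arr :: "'m set"
  Dom :: "'m \<Rightarrow> 'o"
  Cod :: "'m \<Rightarrow> 'o"
  Ident :: "'o \<Rightarrow> 'm"
  Comp :: "'m \<Rightarrow> 'm \<Rightarrow> 'm"  (infixr "\<cdot>\<index>" 75)

definition hom :: "('o, 'm, 'z) category_scheme \<Rightarrow> 'o \<Rightarrow> 'o \<Rightarrow> 'm set" where
  "hom C a b = {f \<in> Arr C. Dom C f = a \<and> Cod C f = b}"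

definition is_category :: "('o, 'm, 'z) category_scheme \<Rightarrow> bool" where
  "is_category C \<longleftrightarrow>
     (\<forall>f\<in>Arr C. Dom C f \<in> Obj C \<and> Cod C f \<in> Obj C) \<and>
     (\<forall>a\<in>Obj C. Ident C a \<in> hom C a a) \<and>
     (\<forall>f\<in>Arr C. \<forall>g\<in>Arr C. Cod C f = Dom C g \<longrightarrow> g \<cdot>\<^bsub>C\<^esub> f \<in> hom C (Dom C f) (Cod C g)) \<and>
     (\<forall>f\<in>Arr C. f \<cdot>\<^bsub>C\<^esub> Ident C (Dom C f) = f \<and> Ident C (Cod C f) \<cdot>\<^bsub>C\<^esub> f = f) \<and>
     (\<forall>f\<in>Arr C. \<forall>g\<in>Arr C. \<forall>h\<in>Arr C. Cod C f = Dom C g \<longrightarrow> Cod C g = Dom C h \<longrightarrow>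
        h \<cdot>\<^bsub>C\<^esub> (g \<cdot>\<^bsub>C\<^esub> f) = (h \<cdot>\<^bsub>C\<^esub> g) \<cdot>\<^bsub>C\<^esub> f)"

definition is_iso :: "('o, 'm, 'z) category_scheme \<Rightarrow> 'm \<Rightarrow> bool" where
  "is_iso C f \<longleftrightarrow> f \<in> Arr C \<and>
     (\<exists>g\<in>hom C (Cod C f) (Dom C f).
        g \<cdot>\<^bsub>C\<^esub> f = Ident C (Dom C f) \<and> f \<cdot>\<^bsub>C\<^esub> g = Ident C (Cod C f))"

definition is_functor ::
  "('i, 'j, 'y) category_scheme \<Rightarrow> ('o, 'm, 'z) category_scheme \<Rightarrow> ('i \<Rightarrow> 'o) \<Rightarrow> ('j \<Rightarrow> 'm) \<Rightarrow> bool" where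
  "is_functor J C Fo Fa \<longleftrightarrow>
     (\<forall>i\<in>Obj J. Fo i \<in> Obj C) \<and>
     (\<forall>u\<in>Arr J. Fa u \<in> hom C (Fo (Dom J u)) (Fo (Cod J u))) \<and>
     (\<forall>i\<in>Obj J. Fa (Ident J i) = Ident C (Fo i)) \<and>
     (\<forall>u\<in>Arr J. \<forall>w\<in>Arr J. Cod J u = Dom J w \<longrightarrow> Fa (w \<cdot>\<^bsub>J\<^esub> u) = Fa w \<cdot>\<^bsub>C\<^esub> Fa u)"

definition is_cone ::
  "('i, 'j, 'y) category_scheme \<Rightarrow> ('o, 'm, 'z) category_scheme \<Rightarrow> ('i \<Rightarrow> 'o) \<Rightarrow> ('j \<Rightarrow> 'm)
     \<Rightarrow> 'o \<Rightarrow> ('i \<Rightarrow> 'm) \<Rightarrow> bool" where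
  "is_cone J C Fo Fa v p \<longleftrightarrow> v \<in> Obj C \<and>
     (\<forall>i\<in>Obj J. p i \<in> hom C v (Fo i)) \<and>
     (\<forall>u\<in>Arr J. Fa u \<cdot>\<^bsub>C\<^esub> p (Dom J u) = p (Cod J u))"

definition is_limit ::
  "('i, 'j, 'y) category_scheme \<Rightarrow> ('o, 'm, 'z) category_scheme \<Rightarrow> ('i \<Rightarrow> 'o) \<Rightarrow> ('j \<Rightarrow> 'm)
     \<Rightarrow> 'o \<Rightarrow> ('i \<Rightarrow> 'm) \<Rightarrow> bool" where
  "is_limit J C Fo Fa v p \<longleftrightarrow> is_cone J C Fo Fa v p \<and>
     (\<forall>w q. is_cone J C Fo Fa w q \<longrightarrow>
        (\<exists>!h. h \<in> hom C w v \<and> (\<forall>i\<in>Obj J. p i \<cdot>\<^bsub>C\<^esub> h = q i)))"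

text \<open>
  HOL cannot quantify over index categories of all types inside a formula.  It suffices to let
  them range over the categories carried by subsets of the arrow type of C: such a C is
  a preorder (Freyd), and therefore has limits of all functors from index categories of
  arbitrary type.  This is lemma \<open>complete_has_limit\<close> below; \<open>continuous_preserves_limit\<close> is the
  analogous fact about \<open>continuous\<close>.
\<close>

definition complete :: "('o, 'm, 'z) category_scheme \<Rightarrow> bool" where
  "complete C \<longleftrightarrow>
     (\<forall>(J :: ('m, 'm) category) Fo Fa. is_category J \<longrightarrow> is_functor J C Fo Fa \<longrightarrow>
        (\<exists>v p. is_limit J C Fo Fa v p))"

definition discrete_category :: "'a set \<Rightarrow> ('a, 'a) category" where
  "discrete_category S = \<lparr>
     Obj = S, Arr = S, Dom = (\<lambda>x. x), Cod = (\<lambda>x. x), Ident = (\<lambda>x. x), Comp = (\<lambda>y x. x) \<rparr>"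

lemma discrete_category_simps [simp]:
  "Obj (discrete_category S) = S" "Arr (discrete_category S) = S"
  "Dom (discrete_category S) x = x" "Cod (discrete_category S) x = x"
  "Ident (discrete_category S) x = x" "Comp (discrete_category S) y x = x"
  by (simp_all add: discrete_category_def)

lemma is_category_discrete: "is_category (discrete_category S)"
  by (simp add: is_category_def hom_def)

lemma comp_in_hom:
  "is_category C \<Longrightarrow> f \<in> hom C a b \<Longrightarrow> g \<in> hom C b c \<Longrightarrow> g \<cdot>\<^bsub>C\<^esub> f \<in> hom C a c"
  by (auto simp: is_category_def hom_def)

lemma ident_in_hom: "is_category C \<Longrightarrow> a \<in> Obj C \<Longrightarrow> Ident C a \<in> hom C a a"
  by (auto simp: is_category_def)

lemma hom_ident_comp: "is_category C \<Longrightarrow> f \<in> hom C a b \<Longrightarrow> Ident C b \<cdot>\<^bsub>C\<^esub> f = f"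
  by (auto simp: is_category_def hom_def)

lemma hom_objs: "is_category C \<Longrightarrow> f \<in> hom C a b \<Longrightarrow> a \<in> Obj C \<and> b \<in> Obj C"
  by (auto simp: is_category_def hom_def)

lemma ident_in_Arr: "is_category C \<Longrightarrow> a \<in> Obj C \<Longrightarrow> Ident C a \<in> Arr C"
  and Dom_Ident: "is_category C \<Longrightarrow> a \<in> Obj C \<Longrightarrow> Dom C (Ident C a) = a"
  and Cod_Ident: "is_category C \<Longrightarrow> a \<in> Obj C \<Longrightarrow> Cod C (Ident C a) = a"
  by (auto simp: is_category_def hom_def)

lemma is_functor_discrete:
  assumes C: "is_category C" and F: "\<And>x. x \<in> S \<Longrightarrow> F x \<in> Obj C"
  shows "is_functor (discrete_category S) C F (\<lambda>x. Ident C (F x))"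
  using ident_in_hom[OF C F] hom_ident_comp[OF C ident_in_hom[OF C F]] F
  by (simp add: is_functor_def)

text \<open>Freyd: a power of \<open>b\<close> indexed by all arrows would have too many arrows from \<open>a\<close>.\<close>

lemma complete_thin:
  assumes C: "is_category C" and compl: "complete C"
    and f: "f \<in> hom C a b" and g: "g \<in> hom C a b"
  shows "f = g"
proof (rule ccontr)
  assume ne: "f \<noteq> g"
  have ab: "a \<in> Obj C" "b \<in> Obj C" using hom_objs[OF C f] by auto
  let ?J = "discrete_category (Arr C)"
  obtain v p where lim: "is_limit ?J C (\<lambda>_. b) (\<lambda>_. Ident C b) v p"
    using compl is_category_discrete[of "Arr C"] is_functor_discrete[OF C, of "Arr C" "\<lambda>_. b"] ab
    unfolding complete_def by blast
  have "\<exists>h. h \<in> hom C a v \<and> (\<forall>j\<in>Arr C. p j \<cdot>\<^bsub>C\<^esub> h = (if j \<in> S then f else g))" for S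
  proof -
    have "is_cone ?J C (\<lambda>_. b) (\<lambda>_. Ident C b) a (\<lambda>j. if j \<in> S then f else g)"
      using f g ab hom_ident_comp[OF C f] hom_ident_comp[OF C g] by (simp add: is_cone_def)
    then have "\<exists>!h. h \<in> hom C a v \<and> (\<forall>j\<in>Obj ?J. p j \<cdot>\<^bsub>C\<^esub> h = (if j \<in> S then f else g))"
      using lim unfolding is_limit_def by blast
    then show ?thesis unfolding discrete_category_simps by (rule ex1_implies_ex)
  qed
  then obtain h where h: "\<And>S. h S \<in> hom C a v"
    "\<And>S j. j \<in> Arr C \<Longrightarrow> p j \<cdot>\<^bsub>C\<^esub> h S = (if j \<in> S then f else g)" by metis
  have "inj_on h (Pow (Arr C))"
  proof (rule inj_onI)
    fix S T assume ST: "S \<in> Pow (Arr C)" "T \<in> Pow (Arr C)" "h S = h T"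
    have "j \<in> S \<longleftrightarrow> j \<in> T" if "j \<in> Arr C" for j
      using h(2)[OF that, of S] h(2)[OF that, of T] ST(3) ne by (metis (full_types))
    then show "S = T" using ST by blast
  qed
  moreover have "h ` Pow (Arr C) \<subseteq> Arr C" using h(1) by (auto simp: hom_def)
  ultimately have "\<exists>k. k ` Arr C = Pow (Arr C)"
    using inj_on_iff_surj[of "Pow (Arr C)" "Arr C"] by blast
  then show False using Cantors_theorem by blast
qed

text \<open>In a preorder, limits are greatest lower bounds of sets of objects.\<close>

lemma thin_limit_iff:
  assumes C: "is_category C" and thin: "\<forall>a b. \<forall>f\<in>hom C a b. \<forall>g\<in>hom C a b. f = g"
    and J: "is_category J" and F: "is_functor J C Fo Fa"
  shows "is_limit J C Fo Fa v p \<longleftrightarrow> v \<in> Obj C \<and> (\<forall>i\<in>Obj J. p i \<in> hom C v (Fo i)) \<and>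
     (\<forall>w\<in>Obj C. (\<forall>i\<in>Obj J. hom C w (Fo i) \<noteq> {}) \<longrightarrow> hom C w v \<noteq> {})"
proof -
  have cone: "is_cone J C Fo Fa w q \<longleftrightarrow> w \<in> Obj C \<and> (\<forall>i\<in>Obj J. q i \<in> hom C w (Fo i))" for w q
  proof -
    have "Fa u \<cdot>\<^bsub>C\<^esub> q (Dom J u) = q (Cod J u)"
      if q: "\<forall>i\<in>Obj J. q i \<in> hom C w (Fo i)" and u: "u \<in> Arr J" for u
    proof -
      have d: "Dom J u \<in> Obj J" "Cod J u \<in> Obj J" using J u by (auto simp: is_category_def)
      have "Fa u \<in> hom C (Fo (Dom J u)) (Fo (Cod J u))" using F u by (auto simp: is_functor_def)
      then have "Fa u \<cdot>\<^bsub>C\<^esub> q (Dom J u) \<in> hom C w (Fo (Cod J u))"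
        using comp_in_hom[OF C] q d by blast
      then show ?thesis using thin q d by blast
    qed
    then show ?thesis by (auto simp: is_cone_def)
  qed
  show ?thesis
  proof (intro iffI conjI ballI impI)
    assume L: "is_limit J C Fo Fa v p"
    then show "v \<in> Obj C" by (simp add: is_limit_def cone)
    show "p i \<in> hom C v (Fo i)" if "i \<in> Obj J" for i
      using L that by (simp add: is_limit_def cone)
    fix w assume w: "w \<in> Obj C" "\<forall>i\<in>Obj J. hom C w (Fo i) \<noteq> {}"
    then have "is_cone J C Fo Fa w (\<lambda>i. SOME x. x \<in> hom C w (Fo i))"
      by (simp add: cone some_in_eq)
    then show "hom C w v \<noteq> {}" using L unfolding is_limit_def by blast
  next
    assume A: "v \<in> Obj C \<and> (\<forall>i\<in>Obj J. p i \<in> hom C v (Fo i)) \<and>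
     (\<forall>w\<in>Obj C. (\<forall>i\<in>Obj J. hom C w (Fo i) \<noteq> {}) \<longrightarrow> hom C w v \<noteq> {})"
    show "is_limit J C Fo Fa v p" unfolding is_limit_def
    proof (intro conjI allI impI)
      show "is_cone J C Fo Fa v p" using A by (simp add: cone)
      fix w q assume "is_cone J C Fo Fa w q"
      then have w: "w \<in> Obj C" and q: "\<And>i. i \<in> Obj J \<Longrightarrow> q i \<in> hom C w (Fo i)"
        by (auto simp: cone)
      then obtain h where h: "h \<in> hom C w v" using A by blast
      have "p i \<cdot>\<^bsub>C\<^esub> h = q i" if "i \<in> Obj J" for i
        using thin comp_in_hom[OF C h] A q[OF that] that by blast
      then show "\<exists>!h. h \<in> hom C w v \<and> (\<forall>i\<in>Obj J. p i \<cdot>\<^bsub>C\<^esub> h = q i)"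
        using h thin by blast
    qed
  qed
qed

lemma complete_has_limit:
  assumes C: "is_category C" and compl: "complete C"
    and J: "is_category J" and F: "is_functor J C Fo Fa"
  shows "\<exists>v p. is_limit J C Fo Fa v p"
proof -
  note thin = complete_thin[OF C compl]
  have thin': "\<forall>a b. \<forall>f\<in>hom C a b. \<forall>g\<in>hom C a b. f = g" using thin by blast
  have Fo: "\<And>i. i \<in> Obj J \<Longrightarrow> Fo i \<in> Obj C" using F by (simp add: is_functor_def)
  let ?S = "(\<lambda>i. Ident C (Fo i)) ` Obj J"
  have D: "is_functor (discrete_category ?S) C (Dom C) (\<lambda>x. Ident C (Dom C x))"
    using Fo by (intro is_functor_discrete[OF C]) (auto simp: Dom_Ident[OF C])
  obtain v p where "is_limit (discrete_category ?S) C (Dom C) (\<lambda>x. Ident C (Dom C x)) v p"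
    using compl is_category_discrete D unfolding complete_def by blast
  then have "is_limit J C Fo Fa v (\<lambda>i. p (Ident C (Fo i)))"
    unfolding thin_limit_iff[OF C thin' is_category_discrete D] thin_limit_iff[OF C thin' J F]
    by (simp add: Dom_Ident[OF C Fo])
  then show ?thesis by blast
qed


section \<open>Symmetric monoidal categories\<close>

record ('o, 'm) smc = "('o, 'm) category" +
  tensor_obj :: "'o \<Rightarrow> 'o \<Rightarrow> 'o"  (infixl "\<otimes>\<index>" 70)
  tensor_arr :: "'m \<Rightarrow> 'm \<Rightarrow> 'm"  (infixl "\<odot>\<index>" 76)
  unit_obj :: "'o"
  associator :: "'o \<Rightarrow> 'o \<Rightarrow> 'o \<Rightarrow> 'm"
  left_unitor :: "'o \<Rightarrow> 'm"
  right_unitor :: "'o \<Rightarrow> 'm"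
  symmetry :: "'o \<Rightarrow> 'o \<Rightarrow> 'm"

definition tensor_bifunctor :: "('o, 'm, 'z) smc_scheme \<Rightarrow> bool" where
  "tensor_bifunctor C \<longleftrightarrow>
     (\<forall>a\<in>Obj C. \<forall>b\<in>Obj C. a \<otimes>\<^bsub>C\<^esub> b \<in> Obj C \<and>
        Ident C a \<odot>\<^bsub>C\<^esub> Ident C b = Ident C (a \<otimes>\<^bsub>C\<^esub> b)) \<and>
     (\<forall>f\<in>Arr C. \<forall>g\<in>Arr C.
        f \<odot>\<^bsub>C\<^esub> g \<in> hom C (Dom C f \<otimes>\<^bsub>C\<^esub> Dom C g) (Cod C f \<otimes>\<^bsub>C\<^esub> Cod C g)) \<and>
     (\<forall>f\<in>Arr C. \<forall>f'\<in>Arr C. \<forall>g\<in>Arr C. \<forall>g'\<in>Arr C. Cod C f = Dom C f' \<longrightarrow> Cod C g = Dom C g' \<longrightarrow>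
        (f' \<cdot>\<^bsub>C\<^esub> f) \<odot>\<^bsub>C\<^esub> (g' \<cdot>\<^bsub>C\<^esub> g) = (f' \<odot>\<^bsub>C\<^esub> g') \<cdot>\<^bsub>C\<^esub> (f \<odot>\<^bsub>C\<^esub> g))"

definition monoidal_structure :: "('o, 'm, 'z) smc_scheme \<Rightarrow> bool" where
  "monoidal_structure C \<longleftrightarrow>
     unit_obj C \<in> Obj C \<and>
     (\<forall>a\<in>Obj C. \<forall>b\<in>Obj C. \<forall>c\<in>Obj C. is_iso C (associator C a b c) \<and>
        associator C a b c \<in> hom C ((a \<otimes>\<^bsub>C\<^esub> b) \<otimes>\<^bsub>C\<^esub> c) (a \<otimes>\<^bsub>C\<^esub> (b \<otimes>\<^bsub>C\<^esub> c))) \<and>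
     (\<forall>a\<in>Obj C. is_iso C (left_unitor C a) \<and> left_unitor C a \<in> hom C (unit_obj C \<otimes>\<^bsub>C\<^esub> a) a) \<and>
     (\<forall>a\<in>Obj C. is_iso C (right_unitor C a) \<and> right_unitor C a \<in> hom C (a \<otimes>\<^bsub>C\<^esub> unit_obj C) a) \<and>
     (\<forall>f\<in>Arr C. \<forall>g\<in>Arr C. \<forall>h\<in>Arr C.
        associator C (Cod C f) (Cod C g) (Cod C h) \<cdot>\<^bsub>C\<^esub> ((f \<odot>\<^bsub>C\<^esub> g) \<odot>\<^bsub>C\<^esub> h) =
        (f \<odot>\<^bsub>C\<^esub> (g \<odot>\<^bsub>C\<^esub> h)) \<cdot>\<^bsub>C\<^esub> associator C (Dom C f) (Dom C g) (Dom C h)) \<and>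
     (\<forall>f\<in>Arr C. left_unitor C (Cod C f) \<cdot>\<^bsub>C\<^esub> (Ident C (unit_obj C) \<odot>\<^bsub>C\<^esub> f) =
        f \<cdot>\<^bsub>C\<^esub> left_unitor C (Dom C f)) \<and>
     (\<forall>f\<in>Arr C. right_unitor C (Cod C f) \<cdot>\<^bsub>C\<^esub> (f \<odot>\<^bsub>C\<^esub> Ident C (unit_obj C)) =
        f \<cdot>\<^bsub>C\<^esub> right_unitor C (Dom C f)) \<and>
     (\<forall>a\<in>Obj C. \<forall>b\<in>Obj C. \<forall>c\<in>Obj C. \<forall>d\<in>Obj C.
        associator C a b (c \<otimes>\<^bsub>C\<^esub> d) \<cdot>\<^bsub>C\<^esub> associator C (a \<otimes>\<^bsub>C\<^esub> b) c d =
        (Ident C a \<odot>\<^bsub>C\<^esub> associator C b c d) \<cdot>\<^bsub>C\<^esub>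
          (associator C a (b \<otimes>\<^bsub>C\<^esub> c) d \<cdot>\<^bsub>C\<^esub> (associator C a b c \<odot>\<^bsub>C\<^esub> Ident C d))) \<and>
     (\<forall>a\<in>Obj C. \<forall>b\<in>Obj C.
        (Ident C a \<odot>\<^bsub>C\<^esub> left_unitor C b) \<cdot>\<^bsub>C\<^esub> associator C a (unit_obj C) b =
        right_unitor C a \<odot>\<^bsub>C\<^esub> Ident C b)"

definition symmetric_structure :: "('o, 'm, 'z) smc_scheme \<Rightarrow> bool" where
  "symmetric_structure C \<longleftrightarrow>
     (\<forall>a\<in>Obj C. \<forall>b\<in>Obj C. symmetry C a b \<in> hom C (a \<otimes>\<^bsub>C\<^esub> b) (b \<otimes>\<^bsub>C\<^esub> a) \<and>
        symmetry C b a \<cdot>\<^bsub>C\<^esub> symmetry C a b = Ident C (a \<otimes>\<^bsub>C\<^esub> b)) \<and>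
     (\<forall>f\<in>Arr C. \<forall>g\<in>Arr C. symmetry C (Cod C f) (Cod C g) \<cdot>\<^bsub>C\<^esub> (f \<odot>\<^bsub>C\<^esub> g) =
        (g \<odot>\<^bsub>C\<^esub> f) \<cdot>\<^bsub>C\<^esub> symmetry C (Dom C f) (Dom C g)) \<and>
     (\<forall>a\<in>Obj C. \<forall>b\<in>Obj C. \<forall>c\<in>Obj C.
        associator C b c a \<cdot>\<^bsub>C\<^esub> (symmetry C a (b \<otimes>\<^bsub>C\<^esub> c) \<cdot>\<^bsub>C\<^esub> associator C a b c) =
        (Ident C b \<odot>\<^bsub>C\<^esub> symmetry C a c) \<cdot>\<^bsub>C\<^esub>
          (associator C b a c \<cdot>\<^bsub>C\<^esub> (symmetry C a b \<odot>\<^bsub>C\<^esub> Ident C c)))"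

definition symmetric_monoidal_category :: "('o, 'm, 'z) smc_scheme \<Rightarrow> bool" where
  "symmetric_monoidal_category C \<longleftrightarrow>
     is_category C \<and> tensor_bifunctor C \<and> monoidal_structure C \<and> symmetric_structure C"

text \<open>
  All structure isomorphisms, the symmetry included, are identities.  The symmetry has to be
  included: equivariance of an algebra structure on the set of arrows forces
  \<open>X\<^sub>1 \<otimes> X\<^sub>2 = X\<^sub>2 \<otimes> X\<^sub>1\<close>, since this is the target of the operation of the full simplex on two vertices.
\<close>

definition strict :: "('o, 'm, 'z) smc_scheme \<Rightarrow> bool" where
  "strict C \<longleftrightarrow>
     (\<forall>a\<in>Obj C. \<forall>b\<in>Obj C. \<forall>c\<in>Obj C. associator C a b c = Ident C ((a \<otimes>\<^bsub>C\<^esub> b) \<otimes>\<^bsub>C\<^esub> c)) \<and>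
     (\<forall>a\<in>Obj C. left_unitor C a = Ident C a \<and> right_unitor C a = Ident C a) \<and>
     (\<forall>a\<in>Obj C. \<forall>b\<in>Obj C. symmetry C a b = Ident C (a \<otimes>\<^bsub>C\<^esub> b))"

definition continuous :: "('o, 'm, 'z) smc_scheme \<Rightarrow> bool" where
  "continuous C \<longleftrightarrow>
     (\<forall>(J :: ('m, 'm) category) Fo Fa v p. \<forall>a\<in>Obj C.
        is_category J \<longrightarrow> is_functor J C Fo Fa \<longrightarrow> is_limit J C Fo Fa v p \<longrightarrow>
        is_limit J C (\<lambda>i. a \<otimes>\<^bsub>C\<^esub> Fo i) (\<lambda>u. Ident C a \<odot>\<^bsub>C\<^esub> Fa u)
          (a \<otimes>\<^bsub>C\<^esub> v) (\<lambda>i. Ident C a \<odot>\<^bsub>C\<^esub> p i) \<and>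
        is_limit J C (\<lambda>i. Fo i \<otimes>\<^bsub>C\<^esub> a) (\<lambda>u. Fa u \<odot>\<^bsub>C\<^esub> Ident C a)
          (v \<otimes>\<^bsub>C\<^esub> a) (\<lambda>i. p i \<odot>\<^bsub>C\<^esub> Ident C a))"

lemma continuous_preserves_limit:
  assumes smc: "symmetric_monoidal_category C" and compl: "complete C" and cont: "continuous C"
    and J: "is_category J" and F: "is_functor J C Fo Fa" and lim: "is_limit J C Fo Fa v p"
    and a: "a \<in> Obj C"
  shows "is_limit J C (\<lambda>i. a \<otimes>\<^bsub>C\<^esub> Fo i) (\<lambda>u. Ident C a \<odot>\<^bsub>C\<^esub> Fa u)
           (a \<otimes>\<^bsub>C\<^esub> v) (\<lambda>i. Ident C a \<odot>\<^bsub>C\<^esub> p i)" (is ?L)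
    and "is_limit J C (\<lambda>i. Fo i \<otimes>\<^bsub>C\<^esub> a) (\<lambda>u. Fa u \<odot>\<^bsub>C\<^esub> Ident C a)
           (v \<otimes>\<^bsub>C\<^esub> a) (\<lambda>i. p i \<odot>\<^bsub>C\<^esub> Ident C a)" (is ?R)
proof -
  have C: "is_category C" and T: "tensor_bifunctor C"
    using smc by (auto simp: symmetric_monoidal_category_def)
  note thin = complete_thin[OF C compl]
  have thin': "\<forall>a b. \<forall>f\<in>hom C a b. \<forall>g\<in>hom C a b. f = g" using thin by blast
  have Fo: "\<And>i. i \<in> Obj J \<Longrightarrow> Fo i \<in> Obj C" using F by (simp add: is_functor_def)
  have tensor_hom: "f \<odot>\<^bsub>C\<^esub> g \<in> hom C (b \<otimes>\<^bsub>C\<^esub> c) (b' \<otimes>\<^bsub>C\<^esub> c')"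
    if "f \<in> hom C b b'" "g \<in> hom C c c'" for f g b b' c c'
    using T that by (auto simp: tensor_bifunctor_def hom_def)
  have tensor_Obj: "b \<otimes>\<^bsub>C\<^esub> c \<in> Obj C" if "b \<in> Obj C" "c \<in> Obj C" for b c
    using T that by (auto simp: tensor_bifunctor_def)
  have ida: "Ident C a \<in> hom C a a" using ident_in_hom[OF C a] .
  have tensor_functor:
    "is_functor I C (\<lambda>i. a \<otimes>\<^bsub>C\<^esub> Go i) (\<lambda>u. Ident C a \<odot>\<^bsub>C\<^esub> Ga u)"
    "is_functor I C (\<lambda>i. Go i \<otimes>\<^bsub>C\<^esub> a) (\<lambda>u. Ga u \<odot>\<^bsub>C\<^esub> Ident C a)"
    if I: "is_category I" and G: "is_functor I C Go Ga" for I :: "('i, 'j, 'y) category_scheme" and Go Ga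
  proof -
    have G': "\<And>u. u \<in> Arr I \<Longrightarrow> Ga u \<in> hom C (Go (Dom I u)) (Go (Cod I u))"
      "\<And>i. i \<in> Obj I \<Longrightarrow> Go i \<in> Obj C"
      "\<And>i. i \<in> Obj I \<Longrightarrow> Ga (Ident I i) = Ident C (Go i)" using G by (auto simp: is_functor_def)
    have wu: "w \<cdot>\<^bsub>I\<^esub> u \<in> hom I (Dom I u) (Cod I w)"
      if "u \<in> Arr I" "w \<in> Arr I" "Cod I u = Dom I w" for u w
      using I that by (auto simp: is_category_def)
    have tid: "Ident C b \<odot>\<^bsub>C\<^esub> Ident C c = Ident C (b \<otimes>\<^bsub>C\<^esub> c)"
      if "b \<in> Obj C" "c \<in> Obj C" for b c
      using T that by (auto simp: tensor_bifunctor_def)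
    have Gw: "Ga w \<in> hom C (Go (Cod I u)) (Go (Cod I w))"
      if "w \<in> Arr I" "Cod I u = Dom I w" for u w using G'(1)[OF that(1)] that(2) by simp
    have Gwu: "Ga (w \<cdot>\<^bsub>I\<^esub> u) \<in> hom C (Go (Dom I u)) (Go (Cod I w))"
      if "u \<in> Arr I" "w \<in> Arr I" "Cod I u = Dom I w" for u w
      using G'(1)[of "w \<cdot>\<^bsub>I\<^esub> u"] wu[OF that] by (simp add: hom_def)
    show "is_functor I C (\<lambda>i. a \<otimes>\<^bsub>C\<^esub> Go i) (\<lambda>u. Ident C a \<odot>\<^bsub>C\<^esub> Ga u)"
      unfolding is_functor_def
      using tensor_Obj a G' tensor_hom[OF ida] tid
        thin[OF tensor_hom[OF ida Gwu] comp_in_hom[OF C tensor_hom[OF ida G'(1)] tensor_hom[OF ida Gw]]]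
      by auto
    show "is_functor I C (\<lambda>i. Go i \<otimes>\<^bsub>C\<^esub> a) (\<lambda>u. Ga u \<odot>\<^bsub>C\<^esub> Ident C a)"
      unfolding is_functor_def
      using tensor_Obj a G' tensor_hom[OF _ ida] tid
        thin[OF tensor_hom[OF Gwu ida] comp_in_hom[OF C tensor_hom[OF G'(1) ida] tensor_hom[OF Gw ida]]]
      by auto
  qed
  let ?S = "(\<lambda>i. Ident C (Fo i)) ` Obj J"
  let ?D = "discrete_category ?S"
  let ?Fa = "\<lambda>x. Ident C (Dom C x)"
  have D: "is_functor ?D C (Dom C) ?Fa"
    using Fo by (intro is_functor_discrete[OF C]) (auto simp: Dom_Ident[OF C])
  have Da: "is_functor ?D C (\<lambda>x. a \<otimes>\<^bsub>C\<^esub> Dom C x) (\<lambda>x. Ident C a \<odot>\<^bsub>C\<^esub> ?Fa x)"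
    "is_functor ?D C (\<lambda>x. Dom C x \<otimes>\<^bsub>C\<^esub> a) (\<lambda>x. ?Fa x \<odot>\<^bsub>C\<^esub> Ident C a)"
    by (rule tensor_functor[OF is_category_discrete D])+
  note tl = thin_limit_iff[OF C thin']
  have v: "v \<in> Obj C" and p: "\<And>i. i \<in> Obj J \<Longrightarrow> p i \<in> hom C v (Fo i)"
    and glb: "\<And>w. w \<in> Obj C \<Longrightarrow> (\<And>i. i \<in> Obj J \<Longrightarrow> hom C w (Fo i) \<noteq> {}) \<Longrightarrow> hom C w v \<noteq> {}"
    using lim unfolding tl[OF J F] by auto
  define q where "q x = (SOME h. h \<in> hom C v (Dom C x))" for x
  have q: "q x \<in> hom C v (Dom C x)" if "x \<in> ?S" for x
    using that p unfolding q_def by (fastforce simp: Dom_Ident[OF C Fo] some_in_eq)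
  have "is_limit ?D C (Dom C) ?Fa v q"
    unfolding tl[OF is_category_discrete D] using v q glb by (auto simp: Dom_Ident[OF C Fo])
  then have lims:
    "is_limit ?D C (\<lambda>x. a \<otimes>\<^bsub>C\<^esub> Dom C x) (\<lambda>x. Ident C a \<odot>\<^bsub>C\<^esub> ?Fa x)
       (a \<otimes>\<^bsub>C\<^esub> v) (\<lambda>x. Ident C a \<odot>\<^bsub>C\<^esub> q x)"
    "is_limit ?D C (\<lambda>x. Dom C x \<otimes>\<^bsub>C\<^esub> a) (\<lambda>x. ?Fa x \<odot>\<^bsub>C\<^esub> Ident C a)
       (v \<otimes>\<^bsub>C\<^esub> a) (\<lambda>x. q x \<odot>\<^bsub>C\<^esub> Ident C a)"
    using cont a is_category_discrete D unfolding continuous_def by blast+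
  show ?L
    using lims(1) p unfolding tl[OF is_category_discrete Da(1)] tl[OF J tensor_functor(1)[OF J F]]
    by (auto simp: Dom_Ident[OF C Fo] intro: tensor_hom ida)
  show ?R
    using lims(2) p unfolding tl[OF is_category_discrete Da(2)] tl[OF J tensor_functor(2)[OF J F]]
    by (auto simp: Dom_Ident[OF C Fo] intro: tensor_hom ida)
qed


section \<open>The operads of simplicial complexes\<close>

text \<open>
  Operads in sets, concentrated in arities \<open>n \<ge> 1\<close>.  \<open>pcomp P n m k\<close> is the partial composition
  from \<open>P(n) \<times> P(m)\<close> to \<open>P(n + m - 1)\<close>, and \<open>act P n\<close> is a left action of the permutations of
  \<open>{1..n}\<close>.
\<close>

record 'p operad =
  ops :: "nat \<Rightarrow> 'p set"
  opunit :: "'p"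
  pcomp :: "nat \<Rightarrow> nat \<Rightarrow> nat \<Rightarrow> 'p \<Rightarrow> 'p \<Rightarrow> 'p"
  act :: "nat \<Rightarrow> (nat \<Rightarrow> nat) \<Rightarrow> 'p \<Rightarrow> 'p"

definition operad_morphism :: "'p operad \<Rightarrow> 'q operad \<Rightarrow> (nat \<Rightarrow> 'p \<Rightarrow> 'q) \<Rightarrow> bool" where
  "operad_morphism P Q h \<longleftrightarrow>
     (\<forall>n\<ge>1. \<forall>p\<in>ops P n. h n p \<in> ops Q n) \<and>
     h 1 (opunit P) = opunit Q \<and>
     (\<forall>n\<ge>1. \<forall>m\<ge>1. \<forall>k\<in>{1..n}. \<forall>p\<in>ops P n. \<forall>q\<in>ops P m.
        h (n + m - 1) (pcomp P n m k p q) = pcomp Q n m k (h n p) (h m q)) \<and>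
     (\<forall>n\<ge>1. \<forall>\<sigma>. \<sigma> permutes {1..n} \<longrightarrow>
        (\<forall>p\<in>ops P n. h n (act P n \<sigma> p) = act Q n \<sigma> (h n p)))"

text \<open>\<open>X^n\<close> is the set \<open>{1..n} \<rightarrow>\<^sub>E X\<close> of extensional functions.\<close>

definition End_operad :: "'x set \<Rightarrow> ((nat \<Rightarrow> 'x) \<Rightarrow> 'x) operad" where
  "End_operad X = \<lparr>
     ops = (\<lambda>n. ({1..n} \<rightarrow>\<^sub>E X) \<rightarrow>\<^sub>E X),
     opunit = (\<lambda>x \<in> {1..1} \<rightarrow>\<^sub>E X. x 1),
     pcomp = (\<lambda>n m k \<phi> \<psi>. \<lambda>x \<in> {1..n + m - 1} \<rightarrow>\<^sub>E X.
        \<phi> (\<lambda>i\<in>{1..n}. if i < k then x i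
                      else if i = k then \<psi> (\<lambda>j\<in>{1..m}. x (j + (k - 1)))
                      else x (i + (m - 1)))),
     act = (\<lambda>n \<sigma> \<phi>. \<lambda>x \<in> {1..n} \<rightarrow>\<^sub>E X. \<phi> (\<lambda>i\<in>{1..n}. x (\<sigma> i))) \<rparr>"

definition operad_algebra :: "'p operad \<Rightarrow> 'x set \<Rightarrow> (nat \<Rightarrow> 'p \<Rightarrow> (nat \<Rightarrow> 'x) \<Rightarrow> 'x) \<Rightarrow> bool" where
  "operad_algebra P X \<mu> \<longleftrightarrow> operad_morphism P (End_operad X) \<mu>"

definition scpx :: "nat \<Rightarrow> nat set set set" where
  "scpx n = {K. K \<noteq> {} \<and> K \<subseteq> Pow {1..n} \<and> (\<forall>I\<in>K. \<forall>J. J \<subseteq> I \<longrightarrow> J \<in> K)}"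

definition shift :: "nat set \<Rightarrow> nat \<Rightarrow> nat set" where
  "shift I l = (\<lambda>i. i + l) ` I"

definition subst_face :: "nat \<Rightarrow> nat \<Rightarrow> nat set \<Rightarrow> nat set \<Rightarrow> nat set" where
  "subst_face m k I J =
     (if k \<in> I then {i\<in>I. i < k} \<union> shift J (k - 1) \<union> shift {i\<in>I. i > k} (m - 1)
      else {i\<in>I. i < k} \<union> shift {i\<in>I. i > k} (m - 1))"

definition comp_face :: "nat \<Rightarrow> nat \<Rightarrow> nat set \<Rightarrow> nat set \<Rightarrow> nat set" where
  "comp_face m k I J =
     (if k \<in> I then {i\<in>I. i < k} \<union> shift {1..m} (k - 1) \<union> shift {i\<in>I. i > k} (m - 1)
      else {i\<in>I. i < k} \<union> shift J (k - 1) \<union> shift {i\<in>I. i > k} (m - 1))"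

definition substitution_operad :: "nat set set operad" where
  "substitution_operad = \<lparr>
     ops = scpx,
     opunit = {{}, {1}},
     pcomp = (\<lambda>n m k K L. {subst_face m k I J | I J. I \<in> K \<and> J \<in> L}),
     act = (\<lambda>n \<sigma> K. (\<lambda>I. \<sigma> ` I) ` K) \<rparr>"

definition composition_operad :: "nat set set operad" where
  "composition_operad = \<lparr>
     ops = scpx,
     opunit = {{}},
     pcomp = (\<lambda>n m k K L. {S. \<exists>I\<in>K. \<exists>J\<in>L. S \<subseteq> comp_face m k I J}),
     act = (\<lambda>n \<sigma> K. (\<lambda>I. \<sigma> ` I) ` K) \<rparr>"


section \<open>The cubical functor and the canonical morphisms\<close>

definition inclusion_category :: "'a set set \<Rightarrow> ('a set, 'a set \<times> 'a set) category" where
  "inclusion_category P = \<lparr>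
     Obj = P,
     Arr = {(I, J). I \<in> P \<and> J \<in> P \<and> I \<subseteq> J},
     Dom = fst,
     Cod = snd,
     Ident = (\<lambda>I. (I, I)),
     Comp = (\<lambda>w u. (fst u, snd w)) \<rparr>"

text \<open>The opposite of the face poset of \<open>K\<close>, identified with the poset of complements of faces.\<close>

definition cat_op :: "nat \<Rightarrow> nat set set \<Rightarrow> (nat set, nat set \<times> nat set) category" where
  "cat_op n K = inclusion_category ((\<lambda>F. {1..n} - F) ` K)"

primrec big_tensor_obj :: "('o, 'm, 'z) smc_scheme \<Rightarrow> nat \<Rightarrow> (nat \<Rightarrow> 'o) \<Rightarrow> 'o" where
  "big_tensor_obj C 0 Z = unit_obj C"
| "big_tensor_obj C (Suc n) Z = big_tensor_obj C n Z \<otimes>\<^bsub>C\<^esub> Z (Suc n)"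

primrec big_tensor_arr :: "('o, 'm, 'z) smc_scheme \<Rightarrow> nat \<Rightarrow> (nat \<Rightarrow> 'm) \<Rightarrow> 'm" where
  "big_tensor_arr C 0 \<phi> = Ident C (unit_obj C)"
| "big_tensor_arr C (Suc n) \<phi> = big_tensor_arr C n \<phi> \<odot>\<^bsub>C\<^esub> \<phi> (Suc n)"

definition z_obj :: "('o, 'm, 'z) smc_scheme \<Rightarrow> nat \<Rightarrow> (nat \<Rightarrow> 'm) \<Rightarrow> nat set \<Rightarrow> 'o" where
  "z_obj C n f I = big_tensor_obj C n (\<lambda>i. if i \<in> I then Cod C (f i) else Dom C (f i))"

definition z_arr :: "('o, 'm, 'z) smc_scheme \<Rightarrow> nat \<Rightarrow> (nat \<Rightarrow> 'm) \<Rightarrow> nat set \<times> nat set \<Rightarrow> 'm" where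
  "z_arr C n f = (\<lambda>(I, J). big_tensor_arr C n (\<lambda>i.
     if i \<in> I then Ident C (Cod C (f i))
     else if i \<in> J then f i
     else Ident C (Dom C (f i))))"

text \<open>
  A limit is determined only up to unique isomorphism, so these are relations: \<open>g\<close> is the
  canonical morphism for some limit cone \<open>(v, p)\<close> of the restricted cubical functor.  Operad
  algebra laws are equations of arrows, hence can hold only for a suitable choice of the limits
  (in a skeletal C there is only one choice).
\<close>

definition is_lim_to_top ::
  "('o, 'm, 'z) smc_scheme \<Rightarrow> nat \<Rightarrow> nat set set \<Rightarrow> (nat \<Rightarrow> 'm) \<Rightarrow> 'm \<Rightarrow> bool" where
  "is_lim_to_top C n K f g \<longleftrightarrow>
     (\<exists>v p. is_limit (cat_op n K) C (z_obj C n f) (z_arr C n f) v p \<and> g = p {1..n})"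

definition is_bot_to_lim ::
  "('o, 'm, 'z) smc_scheme \<Rightarrow> nat \<Rightarrow> nat set set \<Rightarrow> (nat \<Rightarrow> 'm) \<Rightarrow> 'm \<Rightarrow> bool" where
  "is_bot_to_lim C n K f g \<longleftrightarrow>
     (\<exists>v p. is_limit (cat_op n K) C (z_obj C n f) (z_arr C n f) v p \<and>
        g \<in> hom C (z_obj C n f {}) v \<and>
        (\<forall>I\<in>Obj (cat_op n K). p I \<cdot>\<^bsub>C\<^esub> g = z_arr C n f ({}, I)))"

end

theory Submission
  imports Defs "HOL-Algebra.FiniteProduct"
begin

text \<open>
  By Freyd's argument the category \<open>C\<close> is a preorder, so an arrow is determined by its source and
  its target, a limit is a greatest lower bound, and continuity says that tensoring with an object
  preserves greatest lower bounds.  Strictness makes the objects a commutative monoid under the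
  tensor product.  The cubical functor takes the complement of a face \<open>F\<close> to the product
  \<open>face_obj n f F\<close> of the sources \<open>Y\<^sub>i\<close> with \<open>i \<in> F\<close> and the targets \<open>X\<^sub>i\<close> with \<open>i \<notin> F\<close>, and the limit
  over \<open>K\<close> is the meet of these products over \<open>F \<in> K\<close>.

  Compatibility with composition is distributivity.  If an arrow \<open>g\<close> takes the place of a block of
  \<open>m\<close> inputs at position \<open>k\<close>, then the product at a face \<open>I\<close> is \<open>R \<otimes> Dom g\<close> or \<open>R \<otimes> Cod g\<close>, according
  to whether \<open>k \<in> I\<close>, where \<open>R\<close> is the product over the other positions.  For the substitution operad
  \<open>g\<close> goes from a meet over the faces \<open>J\<close> of \<open>L\<close> to the product at the empty face; for the composition
  operad it goes from the product at the full face to such a meet.  Distributing \<open>R\<close> over the meet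
  yields exactly the products at the faces \<open>I \<circ>\<^sub>k J\<close> of either kind (\<open>le_contract_subst_iff\<close>,
  \<open>le_contract_comp_iff\<close>); the smaller faces that the composition operad adds impose no new condition
  on lower bounds, because \<open>face_obj\<close> is antitone.  Equivariance is commutativity of the product.

  The algebra laws are equations of arrows, whereas a limit is determined only up to isomorphism.
  Choosing the limit as a function of its set of lower bounds alone (\<open>meet_cong\<close>) turns isomorphic
  limits into equal ones.  This choice is overridden in a single place: the operadic unit has to act
  as the identity, so there the limit is read off from the given arrow.  The exception does no harm
  because a composite of complexes is the unit only if both factors are.
\<close>

section \<open>Inserting a block into a set of vertices\<close>

text \<open>The index sets \<open>{1..n}\<close> should not be rewritten to \<open>{Suc 0..n}\<close>.\<close>

declare One_nat_def [simp del]

text \<open>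
  Both operations on faces insert a block of vertices at position \<open>k\<close>, whether or not \<open>k\<close> belongs to
  \<open>I\<close>; they differ only in the set inserted in the two cases.
\<close>

definition splice :: "nat \<Rightarrow> nat \<Rightarrow> nat set \<Rightarrow> nat set \<Rightarrow> nat set" where
  "splice m k I J = {i\<in>I. i < k} \<union> shift J (k - 1) \<union> shift {i\<in>I. i > k} (m - 1)"

lemma subst_face_splice: "subst_face m k I J = splice m k I (if k \<in> I then J else {})"
  by (simp add: subst_face_def splice_def shift_def)

lemma comp_face_splice: "comp_face m k I J = splice m k I (if k \<in> I then {1..m} else J)"
  by (simp add: comp_face_def splice_def)

lemma splice_full:
  assumes k: "k \<in> {1..n}" and m: "m \<ge> 1"
  shows "splice m k {1..n} {1..m} = {1..n + m - 1}"
proof (intro equalityI subsetI)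
  fix i assume i: "i \<in> {1..n + m - 1}"
  consider "i < k" | "k \<le> i" "i \<le> k + m - 1" | "i > k + m - 1" by linarith
  then show "i \<in> splice m k {1..n} {1..m}"
  proof cases
    case 1
    then show ?thesis using i k by (auto simp: splice_def)
  next
    case 2
    then have "i = (i - (k - 1)) + (k - 1)" "i - (k - 1) \<in> {1..m}" using i k by auto
    then show ?thesis unfolding splice_def shift_def by blast
  next
    case 3
    then have "i = (i - (m - 1)) + (m - 1)" "i - (m - 1) \<in> {i \<in> {1..n}. i > k}"
      using i k m by auto
    then show ?thesis unfolding splice_def shift_def by blast
  qed
next
  fix i assume "i \<in> splice m k {1..n} {1..m}"
  then show "i \<in> {1..n + m - 1}" using k m by (auto simp: splice_def shift_def)
qed

text \<open>
  \<open>block\<close> and \<open>contract\<close> are the arguments of the inner and of the outer operation in a partial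
  composition of the endomorphism operad.
\<close>

definition block :: "nat \<Rightarrow> nat \<Rightarrow> (nat \<Rightarrow> 'm) \<Rightarrow> nat \<Rightarrow> 'm" where
  "block m k x = (\<lambda>j\<in>{1..m}. x (j + (k - 1)))"

definition contract :: "nat \<Rightarrow> nat \<Rightarrow> nat \<Rightarrow> (nat \<Rightarrow> 'm) \<Rightarrow> 'm \<Rightarrow> nat \<Rightarrow> 'm" where
  "contract n m k x g =
     (\<lambda>i\<in>{1..n}. if i < k then x i else if i = k then g else x (i + (m - 1)))"


section \<open>Meets and tensor products of objects\<close>

locale complete_strict_smc =
  fixes C :: "('o, 'm) smc"
  assumes smc: "symmetric_monoidal_category C"
    and strict: "strict C"
    and complete: "complete C"
    and continuous: "continuous C"
begin

abbreviation le :: "'o \<Rightarrow> 'o \<Rightarrow> bool"  (infix "\<preceq>" 50) where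
  "a \<preceq> b \<equiv> Defs.hom C a b \<noteq> {}"

abbreviation tensor :: "'o \<Rightarrow> 'o \<Rightarrow> 'o"  (infixl "\<star>" 70) where
  "a \<star> b \<equiv> tensor_obj C a b"

definition obj_monoid :: "'o monoid" where
  "obj_monoid = \<lparr>carrier = Obj C, mult = tensor_obj C, one = unit_obj C\<rparr>"

definition arrow :: "'o \<Rightarrow> 'o \<Rightarrow> 'm" where
  "arrow a b = (SOME h. h \<in> Defs.hom C a b)"

definition is_glb :: "'o set \<Rightarrow> 'o \<Rightarrow> bool" where
  "is_glb S v \<longleftrightarrow> v \<in> Obj C \<and> (\<forall>w\<in>Obj C. w \<preceq> v \<longleftrightarrow> (\<forall>s\<in>S. w \<preceq> s))"

text \<open>
  The choice depends on the set of lower bounds of \<open>S\<close> only.  This is what makes equations between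
  chosen limits hold on the nose.
\<close>

definition meet :: "'o set \<Rightarrow> 'o" where
  "meet S = (SOME v. is_glb S v)"

lemma category: "is_category C" and bifunctor: "tensor_bifunctor C"
  and monoidal: "monoidal_structure C" and symmetric: "symmetric_structure C"
  using smc by (auto simp: symmetric_monoidal_category_def)

lemma thin: "f \<in> Defs.hom C a b \<Longrightarrow> g \<in> Defs.hom C a b \<Longrightarrow> f = g"
  using complete_thin[OF category complete] .

lemma thin': "\<forall>a b. \<forall>f\<in>Defs.hom C a b. \<forall>g\<in>Defs.hom C a b. f = g"
  using thin by blast

lemma arrow_in_hom: "a \<preceq> b \<Longrightarrow> arrow a b \<in> Defs.hom C a b"
  unfolding arrow_def by (rule someI_ex) blast

lemma dom_le_cod: "f \<in> Arr C \<Longrightarrow> Dom C f \<preceq> Cod C f"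
  by (auto simp: Defs.hom_def)

lemma dom_cod_Obj [simp]: "f \<in> Arr C \<Longrightarrow> Dom C f \<in> Obj C" "f \<in> Arr C \<Longrightarrow> Cod C f \<in> Obj C"
  using category by (auto simp: is_category_def)

lemma le_refl: "a \<in> Obj C \<Longrightarrow> a \<preceq> a"
  using ident_in_hom[OF category] by blast

lemma le_trans: "a \<preceq> b \<Longrightarrow> b \<preceq> c \<Longrightarrow> a \<preceq> c"
  using comp_in_hom[OF category] by blast

lemma tensor_arr_in_hom:
  "f \<in> Defs.hom C a b \<Longrightarrow> g \<in> Defs.hom C c d \<Longrightarrow> tensor_arr C f g \<in> Defs.hom C (a \<star> c) (b \<star> d)"
  using bifunctor by (auto simp: tensor_bifunctor_def Defs.hom_def)

lemma obj_monoid_simps [simp]: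
  "carrier obj_monoid = Obj C" "mult obj_monoid = tensor_obj C" "one obj_monoid = unit_obj C"
  by (simp_all add: obj_monoid_def)

text \<open>
  An identity that is also an arrow from \<open>a\<close> to \<open>b\<close> forces \<open>a = b\<close>, so the coherence isomorphisms
  of a strict category witness equations between objects.
\<close>

lemma comm_monoid_obj: "comm_monoid obj_monoid"
proof (rule comm_monoidI; simp)
  note cod = Cod_Ident[OF category]
  show closed: "a \<star> b \<in> Obj C" if "a \<in> Obj C" "b \<in> Obj C" for a b
    using bifunctor that by (auto simp: tensor_bifunctor_def)
  show e: "unit_obj C \<in> Obj C"
    using monoidal by (simp add: monoidal_structure_def)
  show "a \<star> b \<star> c = a \<star> (b \<star> c)" if "a \<in> Obj C" "b \<in> Obj C" "c \<in> Obj C" for a b c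
  proof -
    have "Ident C (a \<star> b \<star> c) \<in> Defs.hom C (a \<star> b \<star> c) (a \<star> (b \<star> c))"
      using monoidal strict that unfolding monoidal_structure_def strict_def by metis
    then show ?thesis using cod[OF closed[OF closed]] that by (simp add: Defs.hom_def)
  qed
  show "unit_obj C \<star> a = a" if "a \<in> Obj C" for a
  proof -
    have "Ident C a \<in> Defs.hom C (unit_obj C \<star> a) a"
      using monoidal strict that unfolding monoidal_structure_def strict_def by metis
    then show ?thesis using Dom_Ident[OF category] that by (simp add: Defs.hom_def)
  qed
  show "a \<star> b = b \<star> a" if "a \<in> Obj C" "b \<in> Obj C" for a b
  proof -
    have "Ident C (a \<star> b) \<in> Defs.hom C (a \<star> b) (b \<star> a)"
      using symmetric strict that unfolding symmetric_structure_def strict_def by metis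
    then show ?thesis using cod[OF closed] that by (simp add: Defs.hom_def)
  qed
qed

sublocale objs: comm_monoid obj_monoid
  by (rule comm_monoid_obj)

lemma tensor_Obj: "a \<in> Obj C \<Longrightarrow> b \<in> Obj C \<Longrightarrow> a \<star> b \<in> Obj C"
  using objs.m_closed by simp

lemma is_limit_discrete_iff:
  assumes FF: "is_functor (discrete_category I) C F Fa"
    and p: "\<And>i. i \<in> I \<Longrightarrow> p i \<in> Defs.hom C v (F i)"
  shows "is_limit (discrete_category I) C F Fa v p \<longleftrightarrow> is_glb (F ` I) v"
  unfolding thin_limit_iff[OF category thin' is_category_discrete FF] is_glb_def
proof -
  have "w \<preceq> F i" if "w \<preceq> v" "i \<in> I" for w i
    using le_trans[OF that(1)] p[OF that(2)] by blast
  then show "(v \<in> Obj C \<and> (\<forall>i\<in>Obj (discrete_category I). p i \<in> Defs.hom C v (F i)) \<and>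
      (\<forall>w\<in>Obj C. (\<forall>i\<in>Obj (discrete_category I). w \<preceq> F i) \<longrightarrow> w \<preceq> v)) \<longleftrightarrow>
    (v \<in> Obj C \<and> (\<forall>w\<in>Obj C. (w \<preceq> v) = (\<forall>s\<in>F ` I. w \<preceq> s)))"
    unfolding discrete_category_simps ball_simps(9) using p by blast
qed

lemma meet_is_glb:
  assumes S: "S \<subseteq> Obj C"
  shows "is_glb S (meet S)"
proof -
  have F: "is_functor (discrete_category S) C (\<lambda>x. x) (\<lambda>x. Ident C x)"
    using is_functor_discrete[OF category, of S "\<lambda>x. x"] S by auto
  obtain v p where l: "is_limit (discrete_category S) C (\<lambda>x. x) (\<lambda>x. Ident C x) v p"
    using complete_has_limit[OF category complete is_category_discrete F] by blast
  have "\<And>i. i \<in> S \<Longrightarrow> p i \<in> Defs.hom C v i"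
    using l by (simp add: is_limit_def is_cone_def)
  then have "is_glb S v" using is_limit_discrete_iff[OF F, of p v] l S by auto
  then show ?thesis unfolding meet_def by (rule someI)
qed

lemma meet_cong:
  assumes "\<And>w. w \<in> Obj C \<Longrightarrow> (\<forall>s\<in>S. w \<preceq> s) \<longleftrightarrow> (\<forall>t\<in>T. w \<preceq> t)"
  shows "meet S = meet T"
proof -
  have "is_glb S = is_glb T" using assms by (auto simp: is_glb_def fun_eq_iff)
  then show ?thesis by (simp add: meet_def)
qed

text \<open>Continuity, applied to a greatest lower bound viewed as the limit of a discrete diagram.\<close>

lemma le_tensor_glb_iff:
  assumes S: "S \<subseteq> Obj C" and v: "is_glb S v" and a: "a \<in> Obj C" and w: "w \<in> Obj C"
  shows "w \<preceq> a \<star> v \<longleftrightarrow> (\<forall>s\<in>S. w \<preceq> a \<star> s)"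
proof -
  let ?p = "\<lambda>s. arrow v s"
  have F: "is_functor (discrete_category S) C (\<lambda>x. x) (\<lambda>x. Ident C x)"
    using is_functor_discrete[OF category, of S "\<lambda>x. x"] S by auto
  have p: "?p s \<in> Defs.hom C v s" if "s \<in> S" for s
    using v that le_refl by (intro arrow_in_hom) (auto simp: is_glb_def)
  have "is_limit (discrete_category S) C (\<lambda>x. x) (\<lambda>x. Ident C x) v ?p"
    by (rule iffD2[OF is_limit_discrete_iff[OF F p]]) (use v S in auto)
  note lim = continuous_preserves_limit(1)[OF smc complete continuous is_category_discrete F this a]
  have "Ident C a \<in> Defs.hom C a a" using ident_in_hom[OF category a] .
  note q = tensor_arr_in_hom[OF this]
  have aS: "\<And>s. s \<in> S \<Longrightarrow> a \<star> s \<in> Obj C" using tensor_Obj[OF a] S by auto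
  have "tensor_arr C (Ident C a) (Ident C s) = Ident C (a \<star> s)" if "s \<in> S" for s
    using S a bifunctor that by (auto simp: tensor_bifunctor_def)
  then have "is_functor (discrete_category S) C (\<lambda>s. a \<star> s) (\<lambda>s. tensor_arr C (Ident C a) (Ident C s))"
    using is_functor_discrete[OF category, of S "\<lambda>s. a \<star> s", OF aS] by (simp add: is_functor_def)
  from iffD1[OF is_limit_discrete_iff[OF this q[OF p]] lim]
  have "is_glb ((\<lambda>s. a \<star> s) ` S) (a \<star> v)" .
  then show ?thesis using w by (simp add: is_glb_def)
qed


section \<open>Limits of the cubical functor\<close>

text \<open>
  The value of the cubical functor at the complement of \<open>F\<close>, written as a product over an unordered
  index set so that it can be split and reindexed freely.
\<close>

definition face_obj :: "nat \<Rightarrow> (nat \<Rightarrow> 'm) \<Rightarrow> nat set \<Rightarrow> 'o" where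
  "face_obj n f F = finprod obj_monoid (\<lambda>i. if i \<in> F then Dom C (f i) else Cod C (f i)) {1..n}"

lemma big_tensor_obj_eq_finprod:
  "(\<And>i. i \<in> {1..n} \<Longrightarrow> Z i \<in> Obj C) \<Longrightarrow> big_tensor_obj C n Z = finprod obj_monoid Z {1..n}"
proof (induction n)
  case (Suc n)
  then have "finprod obj_monoid Z {1..n} \<in> Obj C"
    using objs.finprod_closed[of Z "{1..n}"] by auto
  moreover have "finprod obj_monoid Z (insert (Suc n) {1..n}) = Z (Suc n) \<star> finprod obj_monoid Z {1..n}"
    using Suc.prems objs.finprod_insert[of "{1..n}" "Suc n" Z] by auto
  ultimately show ?case
    using Suc objs.m_comm[of "Z (Suc n)" "finprod obj_monoid Z {1..n}"]
    by (simp add: atLeastAtMostSuc_conv)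
qed simp

lemma big_tensor_arr_in_hom:
  "(\<And>i. i \<in> {1..n} \<Longrightarrow> \<phi> i \<in> Defs.hom C (Y i) (X i)) \<Longrightarrow>
    big_tensor_arr C n \<phi> \<in> Defs.hom C (big_tensor_obj C n Y) (big_tensor_obj C n X)"
proof (induction n)
  case 0
  then show ?case using ident_in_hom[OF category] objs.one_closed by simp
next
  case (Suc n)
  then show ?case by (auto intro!: tensor_arr_in_hom)
qed

lemma face_obj_Obj:
  assumes "f \<in> {1..n} \<rightarrow> Arr C"
  shows "face_obj n f F \<in> Obj C"
proof -
  have "\<And>i. i \<in> {1..n} \<Longrightarrow> f i \<in> Arr C" using assms by auto
  then show ?thesis unfolding face_obj_def
    using objs.finprod_closed[of "\<lambda>i. if i \<in> F then Dom C (f i) else Cod C (f i)" "{1..n}"] by auto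
qed

lemma z_obj_complement:
  assumes f: "f \<in> {1..n} \<rightarrow> Arr C"
  shows "z_obj C n f ({1..n} - F) = face_obj n f F"
proof -
  have fi: "\<And>i. i \<in> {1..n} \<Longrightarrow> f i \<in> Arr C" using f by auto
  then show ?thesis
    unfolding z_obj_def face_obj_def
    by (subst big_tensor_obj_eq_finprod) (auto intro!: objs.finprod_cong')
qed

lemma z_arr_in_hom:
  assumes f: "f \<in> {1..n} \<rightarrow> Arr C" and "I \<subseteq> J"
  shows "z_arr C n f (I, J) \<in> Defs.hom C (z_obj C n f I) (z_obj C n f J)"
proof -
  have fi: "f i \<in> Arr C" if "i \<in> {1..n}" for i using f that by auto
  show ?thesis
    unfolding z_arr_def z_obj_def prod.case using assms(2)
    by (intro big_tensor_arr_in_hom) (auto simp: fi ident_in_hom[OF category] Defs.hom_def[of C "Dom C (f _)" "Cod C (f _)"])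
qed

lemma face_obj_antimono:
  assumes f: "f \<in> {1..n} \<rightarrow> Arr C" and "F \<subseteq> G"
  shows "face_obj n f G \<preceq> face_obj n f F"
  using z_arr_in_hom[OF f, of "{1..n} - G" "{1..n} - F"] assms(2)
  by (auto simp: z_obj_complement[OF f])

lemma is_category_inclusion: "is_category (inclusion_category P)"
  by (auto simp: is_category_def inclusion_category_def Defs.hom_def)

text \<open>The equations hold because parallel arrows coincide.\<close>

lemma is_functor_cat_op:
  assumes f: "f \<in> {1..n} \<rightarrow> Arr C"
  shows "is_functor (cat_op n K) C (z_obj C n f) (z_arr C n f)"
proof -
  have o: "z_obj C n f I \<in> Obj C" if "I \<in> Obj (cat_op n K)" for I
    using that face_obj_Obj[OF f]
    by (auto simp: cat_op_def inclusion_category_def z_obj_complement[OF f])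
  show ?thesis
    unfolding is_functor_def
  proof (intro conjI ballI impI)
    fix I assume I: "I \<in> Obj (cat_op n K)"
    show "z_obj C n f I \<in> Obj C" using o I .
    show "z_arr C n f (Ident (cat_op n K) I) = Ident C (z_obj C n f I)"
      using thin[OF z_arr_in_hom[OF f subset_refl] ident_in_hom[OF category o[OF I]]]
      by (simp add: cat_op_def inclusion_category_def)
  next
    fix u assume "u \<in> Arr (cat_op n K)"
    then show "z_arr C n f u \<in>
        Defs.hom C (z_obj C n f (Dom (cat_op n K) u)) (z_obj C n f (Cod (cat_op n K) u))"
      by (auto simp: cat_op_def inclusion_category_def intro: z_arr_in_hom[OF f])
  next
    fix u w assume uw: "u \<in> Arr (cat_op n K)" "w \<in> Arr (cat_op n K)"
      "Cod (cat_op n K) u = Dom (cat_op n K) w"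
    obtain I J H where IJH: "u = (I, J)" "w = (J, H)" "I \<subseteq> J" "J \<subseteq> H"
      using uw by (cases u; cases w) (auto simp: cat_op_def inclusion_category_def)
    have "z_arr C n f (I, H) = Comp C (z_arr C n f (J, H)) (z_arr C n f (I, J))"
      using IJH by (intro thin[OF z_arr_in_hom[OF f] comp_in_hom[OF category z_arr_in_hom[OF f] z_arr_in_hom[OF f]]]) auto
    then show "z_arr C n f (Comp (cat_op n K) w u) = Comp C (z_arr C n f w) (z_arr C n f u)"
      using IJH by (simp add: cat_op_def inclusion_category_def)
  qed
qed

lemma is_limit_cat_op_iff:
  assumes f: "f \<in> {1..n} \<rightarrow> Arr C"
  shows "is_limit (cat_op n K) C (z_obj C n f) (z_arr C n f) v p \<longleftrightarrow>
    is_glb (face_obj n f ` K) v \<and> (\<forall>F\<in>K. p ({1..n} - F) \<in> Defs.hom C v (face_obj n f F))"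
proof -
  have J: "is_category (cat_op n K)" unfolding cat_op_def by (rule is_category_inclusion)
  have obj: "Obj (cat_op n K) = (\<lambda>F. {1..n} - F) ` K"
    by (simp add: cat_op_def inclusion_category_def)
  have p_le: "w \<preceq> face_obj n f F"
    if "w \<preceq> v" "F \<in> K" "\<forall>F\<in>K. p ({1..n} - F) \<in> Defs.hom C v (face_obj n f F)" for w F
    using that by (intro le_trans[OF that(1)]) blast
  have "is_limit (cat_op n K) C (z_obj C n f) (z_arr C n f) v p \<longleftrightarrow>
      v \<in> Obj C \<and> (\<forall>F\<in>K. p ({1..n} - F) \<in> Defs.hom C v (face_obj n f F)) \<and>
      (\<forall>w\<in>Obj C. (\<forall>F\<in>K. w \<preceq> face_obj n f F) \<longrightarrow> w \<preceq> v)"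
    unfolding thin_limit_iff[OF category thin' J is_functor_cat_op[OF f]] obj ball_simps(9)
      z_obj_complement[OF f] ..
  also have "\<dots> \<longleftrightarrow>
      is_glb (face_obj n f ` K) v \<and> (\<forall>F\<in>K. p ({1..n} - F) \<in> Defs.hom C v (face_obj n f F))"
    unfolding is_glb_def ball_simps(9) using p_le by blast
  finally show ?thesis .
qed

text \<open>
  The legs of the limit cone need no construction: any arrows with the right ends will do, and the
  one to the top is \<open>g\<close>.
\<close>

lemma is_lim_to_topI:
  assumes f: "f \<in> {1..n} \<rightarrow> Arr C" and K: "K \<in> scpx n"
    and v: "is_glb (face_obj n f ` K) (Dom C g)" and g: "g \<in> Arr C" "Cod C g = face_obj n f {}"
  shows "is_lim_to_top C n K f g"
proof -
  let ?p = "\<lambda>I. arrow (Dom C g) (z_obj C n f I)"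
  have "{} \<in> K" using K by (auto simp: scpx_def)
  have p: "?p ({1..n} - F) \<in> Defs.hom C (Dom C g) (face_obj n f F)" if "F \<in> K" for F
    unfolding z_obj_complement[OF f]
    using v that le_refl by (intro arrow_in_hom) (auto simp: is_glb_def)
  have "?p {1..n} = g"
    using p[OF \<open>{} \<in> K\<close>] g by (intro thin) (auto simp: Defs.hom_def)
  then show ?thesis
    unfolding is_lim_to_top_def is_limit_cat_op_iff[OF f] using v p
    by (intro exI[of _ "Dom C g"] exI[of _ ?p]) simp
qed

lemma is_bot_to_limI:
  assumes f: "f \<in> {1..n} \<rightarrow> Arr C"
    and v: "is_glb (face_obj n f ` K) (Cod C g)" and g: "g \<in> Arr C" "Dom C g = face_obj n f {1..n}"
  shows "is_bot_to_lim C n K f g"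
proof -
  let ?p = "\<lambda>I. arrow (Cod C g) (z_obj C n f I)"
  have p: "?p ({1..n} - F) \<in> Defs.hom C (Cod C g) (face_obj n f F)" if "F \<in> K" for F
    unfolding z_obj_complement[OF f]
    using v that le_refl by (intro arrow_in_hom) (auto simp: is_glb_def)
  have bot: "z_obj C n f {} = face_obj n f {1..n}"
    using z_obj_complement[OF f, of "{1..n}"] by simp
  have gh: "g \<in> Defs.hom C (z_obj C n f {}) (Cod C g)"
    using g bot by (simp add: Defs.hom_def)
  have "Comp C (?p I) g = z_arr C n f ({}, I)" if I: "I \<in> Obj (cat_op n K)" for I
  proof -
    obtain F where F: "F \<in> K" "I = {1..n} - F"
      using I by (auto simp: cat_op_def inclusion_category_def)
    show ?thesis unfolding F
      using thin[OF comp_in_hom[OF category gh p[OF F(1)]]] z_arr_in_hom[OF f, of "{}" "{1..n} - F"]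
      by (simp add: z_obj_complement[OF f])
  qed
  then show ?thesis
    unfolding is_bot_to_lim_def is_limit_cat_op_iff[OF f] using v p gh
    by (intro exI[of _ "Cod C g"] exI[of _ ?p]) simp
qed


section \<open>Reindexing tensor products\<close>

text \<open>
  The product over the positions other than \<open>k\<close>, the factor \<open>R\<close> of the argument above.
\<close>

definition rest_obj :: "nat \<Rightarrow> nat \<Rightarrow> (nat \<Rightarrow> 'm) \<Rightarrow> nat set \<Rightarrow> 'o" where
  "rest_obj n k f I =
     finprod obj_monoid (\<lambda>i. if i \<in> I then Dom C (f i) else Cod C (f i)) ({1..n} - {k})"

lemma rest_obj_Obj:
  assumes "f \<in> {1..n} \<rightarrow> Arr C"
  shows "rest_obj n k f I \<in> Obj C"
proof -
  have "\<And>i. i \<in> {1..n} \<Longrightarrow> f i \<in> Arr C" using assms by auto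
  then show ?thesis unfolding rest_obj_def
    using objs.finprod_closed[of "\<lambda>i. if i \<in> I then Dom C (f i) else Cod C (f i)" "{1..n} - {k}"] by auto
qed

lemma face_obj_extract:
  assumes f: "f \<in> {1..n} \<rightarrow> Arr C" and k: "k \<in> {1..n}"
  shows "face_obj n f I = rest_obj n k f I \<star> (if k \<in> I then Dom C (f k) else Cod C (f k))"
proof -
  let ?Z = "\<lambda>i. if i \<in> I then Dom C (f i) else Cod C (f i)"
  have Z: "?Z i \<in> Obj C" if "i \<in> {1..n}" for i using funcset_mem[OF f that] by auto
  have "{1..n} = insert k ({1..n} - {k})" using k by auto
  then have "face_obj n f I = finprod obj_monoid ?Z (insert k ({1..n} - {k}))"
    by (simp add: face_obj_def)
  also have "\<dots> = ?Z k \<star> rest_obj n k f I"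
    unfolding rest_obj_def using Z k by (subst objs.finprod_insert) auto
  also have "\<dots> = rest_obj n k f I \<star> ?Z k"
    using objs.m_comm[of "?Z k" "rest_obj n k f I"] Z[OF k] rest_obj_Obj[OF f] by simp
  finally show ?thesis .
qed

lemma block_in: "x \<in> {1..n + m - 1} \<rightarrow> Arr C \<Longrightarrow> k \<in> {1..n} \<Longrightarrow> block m k x \<in> {1..m} \<rightarrow>\<^sub>E Arr C"
  by (auto simp: block_def Pi_iff intro!: bspec[of "{1..n + m - 1}" "\<lambda>i. x i \<in> Arr C"])

lemma contract_in:
  assumes "x \<in> {1..n + m - 1} \<rightarrow> Arr C" and "g \<in> Arr C" and "m \<ge> 1"
  shows "contract n m k x g \<in> {1..n} \<rightarrow>\<^sub>E Arr C"
  using assms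
  by (auto simp: contract_def Pi_iff intro!: bspec[of "{1..n + m - 1}" "\<lambda>i. x i \<in> Arr C"])

text \<open>
  The positions \<open>1, \<dots>, n + m - 1\<close> are the disjoint union of the block \<open>j + (k - 1)\<close> and of the images
  of the positions other than \<open>k\<close>, and the product splits accordingly.
\<close>

lemma face_obj_splice:
  assumes x: "x \<in> {1..n + m - 1} \<rightarrow> Arr C" and g: "g \<in> Arr C"
    and n: "n \<ge> 1" and m: "m \<ge> 1" and k: "k \<in> {1..n}"
    and I: "I \<subseteq> {1..n}" and J: "J \<subseteq> {1..m}"
  shows "face_obj (n + m - 1) x (splice m k I J) =
    rest_obj n k (contract n m k x g) I \<star> face_obj m (block m k x) J"
proof -
  let ?S = "splice m k I J"
  let ?Z = "\<lambda>i. if i \<in> ?S then Dom C (x i) else Cod C (x i)"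
  let ?e = "\<lambda>i. if i < k then i else i + (m - 1)"
  let ?d = "\<lambda>j. j + (k - 1)"
  have Z: "?Z i \<in> Obj C" if "i \<in> {1..n + m - 1}" for i using funcset_mem[OF x that] by auto
  have e_ran: "?e i \<in> {1..n + m - 1}" if "i \<in> {1..n} - {k}" for i using that m k by auto
  have d_ran: "?d j \<in> {1..n + m - 1}" if "j \<in> {1..m}" for j using that m k by auto
  \<comment> \<open>\<open>?e\<close> is injective off \<open>k\<close> and skips the positions \<open>k, \<dots>, k + m - 1\<close>, which are the values of \<open>?d\<close>.\<close>
  have cover: "{1..n + m - 1} = ?e ` ({1..n} - {k}) \<union> ?d ` {1..m}"
  proof (intro equalityI subsetI)
    fix i assume i: "i \<in> {1..n + m - 1}"
    consider "i < k" | "k \<le> i" "i \<le> k + m - 1" | "i > k + m - 1" by linarith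
    then show "i \<in> ?e ` ({1..n} - {k}) \<union> ?d ` {1..m}"
    proof cases
      case 1
      then have "i = ?e i" "i \<in> {1..n} - {k}" using i k by auto
      then show ?thesis by blast
    next
      case 2
      then have "i = ?d (i - (k - 1))" "i - (k - 1) \<in> {1..m}" using i k by auto
      then show ?thesis by blast
    next
      case 3
      then have "i = ?e (i - (m - 1))" "i - (m - 1) \<in> {1..n} - {k}" using i k m by auto
      then show ?thesis by blast
    qed
  next
    fix i assume "i \<in> ?e ` ({1..n} - {k}) \<union> ?d ` {1..m}"
    then show "i \<in> {1..n + m - 1}" using e_ran d_ran by blast
  qed
  have disj: "?e ` ({1..n} - {k}) \<inter> ?d ` {1..m} = {}"
    using k m by (auto split: if_splits)
  have inj: "inj_on ?e ({1..n} - {k})" "inj_on ?d {1..m}"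
    by (auto simp: inj_on_def split: if_splits)
  have eS: "?e i \<in> ?S \<longleftrightarrow> i \<in> I" if "i \<in> {1..n} - {k}" for i
  proof (cases "i < k")
    case True
    then have "i \<noteq> j + (k - 1)" if "j \<in> J" for j using subsetD[OF J that] by auto
    then show ?thesis using True by (auto simp: splice_def shift_def)
  next
    case False
    then have "i > k" using that by auto
    then have "i + (m - 1) \<noteq> j + (k - 1)" if "j \<in> J" for j using subsetD[OF J that] k m by auto
    then show ?thesis using \<open>i > k\<close> by (auto simp: splice_def shift_def)
  qed
  have dS: "?d j \<in> ?S \<longleftrightarrow> j \<in> J" if "j \<in> {1..m}" for j
  proof -
    have "j + (k - 1) \<notin> {i\<in>I. i < k}" using that by auto
    moreover have "j + (k - 1) \<in> shift J (k - 1) \<longleftrightarrow> j \<in> J" by (auto simp: shift_def)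
    moreover have "j + (k - 1) \<noteq> i + (m - 1)" if "i > k" for i
      using that \<open>j \<in> {1..m}\<close> k by auto
    then have "j + (k - 1) \<notin> shift {i\<in>I. i > k} (m - 1)" by (auto simp: shift_def)
    ultimately show ?thesis unfolding splice_def by blast
  qed
  have Pi: "?Z \<in> ?e ` ({1..n} - {k}) \<rightarrow> carrier obj_monoid" "?Z \<in> ?d ` {1..m} \<rightarrow> carrier obj_monoid"
    using Z e_ran d_ran unfolding obj_monoid_simps by blast+
  have "face_obj (n + m - 1) x ?S =
      finprod obj_monoid ?Z (?e ` ({1..n} - {k})) \<star> finprod obj_monoid ?Z (?d ` {1..m})"
    unfolding face_obj_def cover
    using objs.finprod_Un_disjoint[OF finite_imageI finite_imageI disj Pi] by simp
  also have "finprod obj_monoid ?Z (?e ` ({1..n} - {k})) =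
      finprod obj_monoid (\<lambda>i. ?Z (?e i)) ({1..n} - {k})"
    by (rule objs.finprod_reindex[OF Pi(1) inj(1)])
  also have "\<dots> = rest_obj n k (contract n m k x g) I"
    unfolding rest_obj_def
  proof (rule objs.finprod_cong')
    fix i assume i: "i \<in> {1..n} - {k}"
    then have "contract n m k x g i = x (?e i)" by (auto simp: contract_def)
    then show "?Z (?e i) = (if i \<in> I then Dom C (contract n m k x g i) else Cod C (contract n m k x g i))"
      using eS[OF i] by simp
  next
    show "(\<lambda>i. if i \<in> I then Dom C (contract n m k x g i) else Cod C (contract n m k x g i))
        \<in> {1..n} - {k} \<rightarrow> carrier obj_monoid"
      by (auto simp: PiE_mem[OF contract_in[OF x g m]])
  qed simp
  also have "finprod obj_monoid ?Z (?d ` {1..m}) = finprod obj_monoid (\<lambda>j. ?Z (?d j)) {1..m}"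
    by (rule objs.finprod_reindex[OF Pi(2) inj(2)])
  also have "\<dots> = face_obj m (block m k x) J"
    unfolding face_obj_def
  proof (rule objs.finprod_cong')
    fix j assume j: "j \<in> {1..m}"
    then show "?Z (?d j) = (if j \<in> J then Dom C (block m k x j) else Cod C (block m k x j))"
      using dS[OF j] by (simp add: block_def)
  next
    show "(\<lambda>j. if j \<in> J then Dom C (block m k x j) else Cod C (block m k x j))
        \<in> {1..m} \<rightarrow> carrier obj_monoid"
      by (auto simp: PiE_mem[OF block_in[OF x k]])
  qed simp
  finally show ?thesis .
qed

lemma face_obj_permute:
  assumes \<sigma>: "\<sigma> permutes {1..n}" and f: "f \<in> {1..n} \<rightarrow> Arr C"
  shows "face_obj n f (\<sigma> ` I) = face_obj n (\<lambda>i\<in>{1..n}. f (\<sigma> i)) I"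
proof -
  let ?Z = "\<lambda>i. if i \<in> \<sigma> ` I then Dom C (f i) else Cod C (f i)"
  have fi: "f i \<in> Arr C" if "i \<in> {1..n}" for i using f that by auto
  have \<sigma>i: "\<sigma> i \<in> {1..n}" if "i \<in> {1..n}" for i using permutes_in_image[OF \<sigma>] that by blast
  have "face_obj n f (\<sigma> ` I) = finprod obj_monoid ?Z (\<sigma> ` {1..n})"
    using permutes_image[OF \<sigma>] by (simp add: face_obj_def)
  also have "\<dots> = finprod obj_monoid (\<lambda>i. ?Z (\<sigma> i)) {1..n}"
    using fi \<sigma>i permutes_inj_on[OF \<sigma>] by (intro objs.finprod_reindex) auto
  also have "\<dots> = face_obj n (\<lambda>i\<in>{1..n}. f (\<sigma> i)) I"
    unfolding face_obj_def using fi \<sigma>i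
    by (intro objs.finprod_cong') (auto simp: inj_image_mem_iff[OF permutes_inj[OF \<sigma>]])
  finally show ?thesis .
qed

lemma contract_at: "k \<in> {1..n} \<Longrightarrow> contract n m k x g k = g"
  by (simp add: contract_def)

text \<open>
  If \<open>k \<in> I\<close>, the factor at \<open>k\<close> is the meet over \<open>L\<close>, which distributes.  If \<open>k \<notin> I\<close>, the factor is
  the product at the empty face; then the face on the right is the same for every \<open>J\<close>, and there is
  at least one \<open>J\<close>.
\<close>

lemma le_contract_subst_iff:
  assumes x: "x \<in> {1..n + m - 1} \<rightarrow> Arr C" and g: "g \<in> Arr C"
    and n: "n \<ge> 1" and m: "m \<ge> 1" and k: "k \<in> {1..n}"
    and I: "I \<subseteq> {1..n}" and L: "L \<subseteq> Pow {1..m}" "L \<noteq> {}" and w: "w \<in> Obj C"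
    and glb: "is_glb (face_obj m (block m k x) ` L) (Dom C g)"
    and cod: "Cod C g = face_obj m (block m k x) {}"
  shows "w \<preceq> face_obj n (contract n m k x g) I \<longleftrightarrow>
    (\<forall>J\<in>L. w \<preceq> face_obj (n + m - 1) x (subst_face m k I J))"
proof -
  let ?x = "contract n m k x g" and ?y = "block m k x"
  have x': "?x \<in> {1..n} \<rightarrow> Arr C" using contract_in[OF x g m] by blast
  have y: "?y \<in> {1..m} \<rightarrow> Arr C" using block_in[OF x k] by blast
  note ex = face_obj_extract[OF x' k, of I, unfolded contract_at[OF k]]
  note sp = face_obj_splice[OF x g n m k I]
  show ?thesis
  proof (cases "k \<in> I")
    case True
    have "w \<preceq> rest_obj n k ?x I \<star> Dom C g \<longleftrightarrow>
        (\<forall>J\<in>L. w \<preceq> rest_obj n k ?x I \<star> face_obj m ?y J)"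
      using le_tensor_glb_iff[OF _ glb rest_obj_Obj[OF x'] w] face_obj_Obj[OF y] by blast
    moreover have "face_obj (n + m - 1) x (subst_face m k I J) = rest_obj n k ?x I \<star> face_obj m ?y J"
      if "J \<in> L" for J
      using sp[of J] L(1) that True by (auto simp: subst_face_splice)
    ultimately show ?thesis using True ex by simp
  next
    case False
    then show ?thesis using ex sp[of "{}"] L(2) cod by (auto simp: subst_face_splice)
  qed
qed

text \<open>
  Here the two cases are exchanged: the meet over \<open>L\<close> is the target of \<open>g\<close>, and the source is the
  product at the full face.
\<close>

lemma le_contract_comp_iff:
  assumes x: "x \<in> {1..n + m - 1} \<rightarrow> Arr C" and g: "g \<in> Arr C"
    and n: "n \<ge> 1" and m: "m \<ge> 1" and k: "k \<in> {1..n}"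
    and I: "I \<subseteq> {1..n}" and L: "L \<subseteq> Pow {1..m}" "L \<noteq> {}" and w: "w \<in> Obj C"
    and glb: "is_glb (face_obj m (block m k x) ` L) (Cod C g)"
    and dom: "Dom C g = face_obj m (block m k x) {1..m}"
  shows "w \<preceq> face_obj n (contract n m k x g) I \<longleftrightarrow>
    (\<forall>J\<in>L. w \<preceq> face_obj (n + m - 1) x (comp_face m k I J))"
proof -
  let ?x = "contract n m k x g" and ?y = "block m k x"
  have x': "?x \<in> {1..n} \<rightarrow> Arr C" using contract_in[OF x g m] by blast
  have y: "?y \<in> {1..m} \<rightarrow> Arr C" using block_in[OF x k] by blast
  note ex = face_obj_extract[OF x' k, of I, unfolded contract_at[OF k]]
  note sp = face_obj_splice[OF x g n m k I]
  show ?thesis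
  proof (cases "k \<in> I")
    case True
    then show ?thesis using ex sp[of "{1..m}"] L(2) dom by (auto simp: comp_face_splice)
  next
    case False
    have "w \<preceq> rest_obj n k ?x I \<star> Cod C g \<longleftrightarrow>
        (\<forall>J\<in>L. w \<preceq> rest_obj n k ?x I \<star> face_obj m ?y J)"
      using le_tensor_glb_iff[OF _ glb rest_obj_Obj[OF x'] w] face_obj_Obj[OF y] by blast
    moreover have "face_obj (n + m - 1) x (comp_face m k I J) = rest_obj n k ?x I \<star> face_obj m ?y J"
      if "J \<in> L" for J
      using sp[of J] L(1) that False by (auto simp: comp_face_splice)
    ultimately show ?thesis using False ex by simp
  qed
qed


section \<open>The two algebra structures\<close>

lemma ball_image_pairs:
  "(\<forall>s\<in>F ` {h I J | I J. I \<in> K \<and> J \<in> L}. P s) \<longleftrightarrow> (\<forall>I\<in>K. \<forall>J\<in>L. P (F (h I J)))"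
  by blast

lemma ball_image_downset:
  assumes "\<And>S T. S \<subseteq> T \<Longrightarrow> P (F T) \<Longrightarrow> P (F S)"
  shows "(\<forall>s\<in>F ` {S. \<exists>I\<in>K. \<exists>J\<in>L. S \<subseteq> h I J}. P s) \<longleftrightarrow> (\<forall>I\<in>K. \<forall>J\<in>L. P (F (h I J)))"
  using assms by blast

lemma scpx_D: "K \<in> scpx n \<Longrightarrow> {} \<in> K" "K \<in> scpx n \<Longrightarrow> K \<subseteq> Pow {1..n}" "K \<in> scpx n \<Longrightarrow> K \<noteq> {}"
  by (auto simp: scpx_def)

lemma scpx_1_cases:
  assumes "K \<in> scpx 1"
  shows "K = {{}} \<or> K = {{}, {1}}"
proof -
  have "K \<subseteq> {{}, {1}}" using scpx_D(2)[OF assms] by auto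
  then show ?thesis using scpx_D(1)[OF assms] by auto
qed

lemma face_obj_1:
  assumes "f \<in> {1..1} \<rightarrow> Arr C"
  shows "face_obj 1 f F = (if 1 \<in> F then Dom C (f 1) else Cod C (f 1))"
proof -
  have "f 1 \<in> Arr C" using assms by auto
  then show ?thesis
    using face_obj_extract[OF assms, of 1 F] objs.l_one by (simp add: rest_obj_def)
qed

text \<open>
  Since the operadic unit has to act as the identity, its limit must be the source of \<open>f 1\<close> (in
  \<open>bot_to_lim\<close>, the target), and not an isomorphic object.
\<close>

definition lim_to_top :: "nat \<Rightarrow> nat set set \<Rightarrow> (nat \<Rightarrow> 'm) \<Rightarrow> 'm" where
  "lim_to_top n K = (\<lambda>f \<in> {1..n} \<rightarrow>\<^sub>E Arr C.
     if n = 1 \<and> K = {{}, {1}} then f 1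
     else arrow (meet (face_obj n f ` K)) (face_obj n f {}))"

definition bot_to_lim :: "nat \<Rightarrow> nat set set \<Rightarrow> (nat \<Rightarrow> 'm) \<Rightarrow> 'm" where
  "bot_to_lim n K = (\<lambda>f \<in> {1..n} \<rightarrow>\<^sub>E Arr C.
     if n = 1 \<and> K = {{}} then f 1
     else arrow (face_obj n f {1..n}) (meet (face_obj n f ` K)))"

lemma lim_to_top_unit: "f \<in> {1..1} \<rightarrow>\<^sub>E Arr C \<Longrightarrow> lim_to_top 1 {{}, {1}} f = f 1"
  by (simp add: lim_to_top_def)

lemma lim_to_top_nonunit:
  assumes "\<not> (n = 1 \<and> K = {{}, {1}})" and "f \<in> {1..n} \<rightarrow>\<^sub>E Arr C"
  shows "lim_to_top n K f = arrow (meet (face_obj n f ` K)) (face_obj n f {})"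
  unfolding lim_to_top_def restrict_apply'[OF assms(2)] if_not_P[OF assms(1)] ..

lemma bot_to_lim_unit: "f \<in> {1..1} \<rightarrow>\<^sub>E Arr C \<Longrightarrow> bot_to_lim 1 {{}} f = f 1"
  by (simp add: bot_to_lim_def)

lemma bot_to_lim_nonunit:
  assumes "\<not> (n = 1 \<and> K = {{}})" and "f \<in> {1..n} \<rightarrow>\<^sub>E Arr C"
  shows "bot_to_lim n K f = arrow (face_obj n f {1..n}) (meet (face_obj n f ` K))"
  unfolding bot_to_lim_def restrict_apply'[OF assms(2)] if_not_P[OF assms(1)] ..

lemma lim_to_top:
  assumes K: "K \<in> scpx n" and f: "f \<in> {1..n} \<rightarrow>\<^sub>E Arr C"
  shows "lim_to_top n K f \<in> Arr C"
    and "Cod C (lim_to_top n K f) = face_obj n f {}"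
    and "is_glb (face_obj n f ` K) (Dom C (lim_to_top n K f))"
proof -
  let ?g = "lim_to_top n K f"
  have f': "f \<in> {1..n} \<rightarrow> Arr C" using f by blast
  have "?g \<in> Arr C \<and> Cod C ?g = face_obj n f {} \<and> is_glb (face_obj n f ` K) (Dom C ?g)"
  proof (cases "n = 1 \<and> K = {{}, {1}}")
    case True
    then have "f 1 \<in> Arr C" using f by auto
    moreover have "is_glb {Cod C (f 1), Dom C (f 1)} (Dom C (f 1))"
      using calculation le_trans[OF _ dom_le_cod] by (auto simp: is_glb_def)
    ultimately show ?thesis
      using True f face_obj_1[of f] f' by (auto simp: lim_to_top_def)
  next
    case False
    have m: "is_glb (face_obj n f ` K) (meet (face_obj n f ` K))"
      by (rule meet_is_glb) (use face_obj_Obj[OF f'] in auto)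
    then have "meet (face_obj n f ` K) \<preceq> face_obj n f {}"
      using scpx_D(1)[OF K] le_refl by (auto simp: is_glb_def)
    moreover have "?g = arrow (meet (face_obj n f ` K)) (face_obj n f {})"
      by (rule lim_to_top_nonunit[OF False f])
    ultimately show ?thesis using arrow_in_hom m by (simp add: Defs.hom_def)
  qed
  then show "?g \<in> Arr C" "Cod C ?g = face_obj n f {}" "is_glb (face_obj n f ` K) (Dom C ?g)"
    by auto
qed

lemma bot_to_lim:
  assumes K: "K \<in> scpx n" and f: "f \<in> {1..n} \<rightarrow>\<^sub>E Arr C"
  shows "bot_to_lim n K f \<in> Arr C"
    and "Dom C (bot_to_lim n K f) = face_obj n f {1..n}"
    and "is_glb (face_obj n f ` K) (Cod C (bot_to_lim n K f))"
proof -
  let ?g = "bot_to_lim n K f"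
  have f': "f \<in> {1..n} \<rightarrow> Arr C" using f by blast
  have "?g \<in> Arr C \<and> Dom C ?g = face_obj n f {1..n} \<and> is_glb (face_obj n f ` K) (Cod C ?g)"
  proof (cases "n = 1 \<and> K = {{}}")
    case True
    then have "f 1 \<in> Arr C" using f by auto
    then show ?thesis
      using True f face_obj_1[of f] f' by (auto simp: bot_to_lim_def is_glb_def)
  next
    case False
    have m: "is_glb (face_obj n f ` K) (meet (face_obj n f ` K))"
      by (rule meet_is_glb) (use face_obj_Obj[OF f'] in auto)
    have "face_obj n f {1..n} \<preceq> face_obj n f F" if "F \<in> K" for F
      using face_obj_antimono[OF f', of F "{1..n}"] scpx_D(2)[OF K] that by blast
    then have "face_obj n f {1..n} \<preceq> meet (face_obj n f ` K)"
      using m face_obj_Obj[OF f'] by (auto simp: is_glb_def)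
    moreover have "?g = arrow (face_obj n f {1..n}) (meet (face_obj n f ` K))"
      by (rule bot_to_lim_nonunit[OF False f])
    ultimately show ?thesis using arrow_in_hom m by (simp add: Defs.hom_def)
  qed
  then show "?g \<in> Arr C" "Dom C ?g = face_obj n f {1..n}" "is_glb (face_obj n f ` K) (Cod C ?g)"
    by auto
qed

lemma contract_1: "x \<in> {1..m} \<rightarrow>\<^sub>E A \<Longrightarrow> contract 1 m 1 x g 1 = g \<and> block m 1 x = x"
  by (auto simp: contract_def block_def fun_eq_iff PiE_def extensional_def)

text \<open>
  If \<open>K\<close> is the unit, both sides are the operation of \<open>L\<close>.  Otherwise the composite is not the unit
  either, so that both sides are arrows out of a chosen meet, and it suffices to compare lower bounds
  and targets.
\<close>

lemma lim_to_top_comp: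
  assumes n: "n \<ge> 1" and m: "m \<ge> 1" and k: "k \<in> {1..n}" and K: "K \<in> scpx n" and L: "L \<in> scpx m"
    and x: "x \<in> {1..n + m - 1} \<rightarrow>\<^sub>E Arr C"
  shows "lim_to_top (n + m - 1) {subst_face m k I J | I J. I \<in> K \<and> J \<in> L} x =
    lim_to_top n K (contract n m k x (lim_to_top m L (block m k x)))"
proof -
  let ?KL = "{subst_face m k I J | I J. I \<in> K \<and> J \<in> L}"
  let ?g = "lim_to_top m L (block m k x)"
  let ?x = "contract n m k x ?g"
  have x': "x \<in> {1..n + m - 1} \<rightarrow> Arr C" using x by blast
  note g = lim_to_top[OF L block_in[OF x' k]]
  note c = contract_in[OF x' g(1) m, of k]
  show ?thesis
  proof (cases "n = 1 \<and> K = {{}, {1}}")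
    case True
    then have k1: "k = 1" using k by auto
    have "subst_face m 1 {} J = {}" "subst_face m 1 {1} J = J" for J
      by (auto simp: subst_face_def shift_def)
    moreover have "{} \<in> L" using scpx_D(1)[OF L] .
    moreover have "?KL = subst_face m 1 {} ` L \<union> subst_face m 1 {1} ` L"
      using True k1 by blast
    ultimately have "?KL = L" by auto
    moreover have "block m k x = x" "?x 1 = ?g"
      using contract_1[of x m "Arr C"] x True k1 by auto
    ultimately show ?thesis
      using True c lim_to_top_unit[of ?x] by simp
  next
    case False
    have nonunit: "\<not> (n + m - 1 = 1 \<and> ?KL = {{}, {1}})"
    proof
      assume A: "n + m - 1 = 1 \<and> ?KL = {{}, {1}}"
      then have "n = 1" "m = 1" using n m by auto
      \<comment> \<open>The only other complex on one vertex has only the empty face, and so has its composite with \<open>L\<close>.\<close>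
      then have "K = {{}}" using scpx_1_cases K False by blast
      then have "?KL \<subseteq> {{}}" by (auto simp: subst_face_def shift_def)
      moreover have "{1} \<in> ?KL" unfolding conjunct2[OF A] by simp
      ultimately show False by blast
    qed
    have "meet (face_obj (n + m - 1) x ` ?KL) = meet (face_obj n ?x ` K)"
    proof (rule meet_cong)
      fix w assume w: "w \<in> Obj C"
      have "w \<preceq> face_obj n ?x I \<longleftrightarrow> (\<forall>J\<in>L. w \<preceq> face_obj (n + m - 1) x (subst_face m k I J))"
        if "I \<in> K" for I
        using that scpx_D(2)[OF K]
        by (intro le_contract_subst_iff[OF x' g(1) n m k _ scpx_D(2,3)[OF L] w g(3,2)]) auto
      then show "(\<forall>s\<in>face_obj (n + m - 1) x ` ?KL. w \<preceq> s) \<longleftrightarrow> (\<forall>t\<in>face_obj n ?x ` K. w \<preceq> t)"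
        unfolding ball_image_pairs by simp
    qed
    \<comment> \<open>The targets agree: the empty face is the insertion of an empty block into the empty face.\<close>
    moreover have "face_obj (n + m - 1) x {} = face_obj n ?x {}"
    proof -
      have "?x \<in> {1..n} \<rightarrow> Arr C" using c by blast
      from face_obj_extract[OF this k, of "{}"] show ?thesis
        using face_obj_splice[OF x' g(1) n m k, of "{}" "{}"] g(2)
        by (simp add: contract_at[OF k] splice_def shift_def)
    qed
    ultimately show ?thesis
      using lim_to_top_nonunit[OF False c] lim_to_top_nonunit[OF nonunit x] by simp
  qed
qed

lemma bot_to_lim_comp:
  assumes n: "n \<ge> 1" and m: "m \<ge> 1" and k: "k \<in> {1..n}" and K: "K \<in> scpx n" and L: "L \<in> scpx m"
    and x: "x \<in> {1..n + m - 1} \<rightarrow>\<^sub>E Arr C"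
  shows "bot_to_lim (n + m - 1) {S. \<exists>I\<in>K. \<exists>J\<in>L. S \<subseteq> comp_face m k I J} x =
    bot_to_lim n K (contract n m k x (bot_to_lim m L (block m k x)))"
proof -
  let ?KL = "{S. \<exists>I\<in>K. \<exists>J\<in>L. S \<subseteq> comp_face m k I J}"
  let ?g = "bot_to_lim m L (block m k x)"
  let ?x = "contract n m k x ?g"
  have x': "x \<in> {1..n + m - 1} \<rightarrow> Arr C" using x by blast
  note g = bot_to_lim[OF L block_in[OF x' k]]
  note c = contract_in[OF x' g(1) m, of k]
  show ?thesis
  proof (cases "n = 1 \<and> K = {{}}")
    case True
    then have k1: "k = 1" using k by auto
    have "comp_face m 1 {} J = J" for J
      by (auto simp: comp_face_def shift_def)
    then have "?KL = L" using True k1 L by (auto simp: scpx_def)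
    moreover have "block m k x = x" "?x 1 = ?g"
      using contract_1[of x m "Arr C"] x True k1 by auto
    ultimately show ?thesis
      using True c bot_to_lim_unit[of ?x] by simp
  next
    case False
    have nonunit: "\<not> (n + m - 1 = 1 \<and> ?KL = {{}})"
    proof
      assume A: "n + m - 1 = 1 \<and> ?KL = {{}}"
      then have nm: "n = 1" "m = 1" using n m by auto
      \<comment> \<open>The only other complex on one vertex is the full simplex, and so is its composite with \<open>L\<close>.\<close>
      then have "{1} \<in> K" "k = 1" using scpx_1_cases K False k by auto
      then have "{1} \<in> ?KL"
        using scpx_D(1)[OF L] by (auto simp: nm comp_face_def shift_def)
      then show False using A by auto
    qed
    have "meet (face_obj (n + m - 1) x ` ?KL) = meet (face_obj n ?x ` K)"
    proof (rule meet_cong)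
      fix w assume w: "w \<in> Obj C"
      have "w \<preceq> face_obj n ?x I \<longleftrightarrow> (\<forall>J\<in>L. w \<preceq> face_obj (n + m - 1) x (comp_face m k I J))"
        if "I \<in> K" for I
        using that scpx_D(2)[OF K]
        by (intro le_contract_comp_iff[OF x' g(1) n m k _ scpx_D(2,3)[OF L] w g(3,2)]) auto
      moreover have "w \<preceq> face_obj (n + m - 1) x S"
        if "S \<subseteq> T" "w \<preceq> face_obj (n + m - 1) x T" for S T
        using le_trans[OF that(2) face_obj_antimono[OF x' that(1)]] .
      then have "(\<forall>s\<in>face_obj (n + m - 1) x ` ?KL. w \<preceq> s) \<longleftrightarrow>
          (\<forall>I\<in>K. \<forall>J\<in>L. w \<preceq> face_obj (n + m - 1) x (comp_face m k I J))"
        by (rule ball_image_downset)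
      ultimately show "(\<forall>s\<in>face_obj (n + m - 1) x ` ?KL. w \<preceq> s) \<longleftrightarrow> (\<forall>t\<in>face_obj n ?x ` K. w \<preceq> t)"
        by simp
    qed
    \<comment> \<open>The sources agree: the full face is the insertion of a full block into the full face.\<close>
    moreover have "face_obj (n + m - 1) x {1..n + m - 1} = face_obj n ?x {1..n}"
    proof -
      have "?x \<in> {1..n} \<rightarrow> Arr C" using c by blast
      then show ?thesis
        using face_obj_extract[of ?x n k "{1..n}"] k g(2)
          face_obj_splice[OF x' g(1) n m k, of "{1..n}" "{1..m}"]
        by (simp add: contract_at[OF k] splice_full[OF k m])
    qed
    ultimately show ?thesis
      using bot_to_lim_nonunit[OF False c] bot_to_lim_nonunit[OF nonunit x] by simp
  qed
qed

lemma permutes_1: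
  assumes "\<sigma> permutes {1..1::nat}"
  shows "\<sigma> = id"
  using assms permutes_sing[of \<sigma> 1] by simp

lemma permute_in:
  assumes "\<sigma> permutes {1..n}" and "f \<in> {1..n} \<rightarrow>\<^sub>E A"
  shows "(\<lambda>i\<in>{1..n}. f (\<sigma> i)) \<in> {1..n} \<rightarrow>\<^sub>E A"
  using assms permutes_in_image[OF assms(1)] by (auto simp: PiE_iff)

lemma face_obj_permute_image:
  assumes "\<sigma> permutes {1..n}" and "f \<in> {1..n} \<rightarrow>\<^sub>E Arr C"
  shows "face_obj n f ` (\<lambda>I. \<sigma> ` I) ` K = face_obj n (\<lambda>i\<in>{1..n}. f (\<sigma> i)) ` K"
proof -
  have "f \<in> {1..n} \<rightarrow> Arr C" using assms(2) by blast
  then show ?thesis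
    unfolding image_image by (intro image_cong refl face_obj_permute[OF assms(1)])
qed

lemma lim_to_top_permute:
  assumes \<sigma>: "\<sigma> permutes {1..n}" and f: "f \<in> {1..n} \<rightarrow>\<^sub>E Arr C"
  shows "lim_to_top n ((\<lambda>I. \<sigma> ` I) ` K) f = lim_to_top n K (\<lambda>i\<in>{1..n}. f (\<sigma> i))"
proof (cases "n = 1")
  \<comment> \<open>In arity 1, where the unit makes an exception, the only permutation is the identity.\<close>
  case True
  then show ?thesis using permutes_1 \<sigma> f by simp
next
  let ?f = "\<lambda>i\<in>{1..n}. f (\<sigma> i)"
  case False
  have "face_obj n f {} = face_obj n (\<lambda>i\<in>{1..n}. f (\<sigma> i)) {}"
    using face_obj_permute[OF \<sigma>, of f "{}"] f by auto
  then have "arrow (meet (face_obj n f ` (\<lambda>I. \<sigma> ` I) ` K)) (face_obj n f {}) = arrow (meet (face_obj n ?f ` K)) (face_obj n ?f {})"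
    by (simp only: face_obj_permute_image[OF \<sigma> f])
  then show ?thesis
    using False lim_to_top_nonunit[OF _ f] lim_to_top_nonunit[OF _ permute_in[OF \<sigma> f]] by simp
qed

lemma bot_to_lim_permute:
  assumes \<sigma>: "\<sigma> permutes {1..n}" and f: "f \<in> {1..n} \<rightarrow>\<^sub>E Arr C"
  shows "bot_to_lim n ((\<lambda>I. \<sigma> ` I) ` K) f = bot_to_lim n K (\<lambda>i\<in>{1..n}. f (\<sigma> i))"
proof (cases "n = 1")
  \<comment> \<open>In arity 1, where the unit makes an exception, the only permutation is the identity.\<close>
  case True
  then show ?thesis using permutes_1 \<sigma> f by simp
next
  let ?f = "\<lambda>i\<in>{1..n}. f (\<sigma> i)"
  case False
  have "face_obj n f {1..n} = face_obj n (\<lambda>i\<in>{1..n}. f (\<sigma> i)) {1..n}"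
    using face_obj_permute[OF \<sigma>, of f "{1..n}"] f permutes_image[OF \<sigma>] by auto
  then have "arrow (face_obj n f {1..n}) (meet (face_obj n f ` (\<lambda>I. \<sigma> ` I) ` K)) = arrow (face_obj n ?f {1..n}) (meet (face_obj n ?f ` K))"
    by (simp only: face_obj_permute_image[OF \<sigma> f])
  then show ?thesis
    using False bot_to_lim_nonunit[OF _ f] bot_to_lim_nonunit[OF _ permute_in[OF \<sigma> f]] by simp
qed

lemma substitution_algebra: "operad_algebra substitution_operad (Arr C) lim_to_top"
  unfolding operad_algebra_def operad_morphism_def
proof (intro conjI allI impI ballI)
  fix n K assume "K \<in> ops substitution_operad n"
  then have K: "K \<in> scpx n" by (simp add: substitution_operad_def)
  show "lim_to_top n K \<in> ops (End_operad (Arr C)) n"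
    using lim_to_top(1)[OF K] by (auto simp: End_operad_def lim_to_top_def)
next
  show "lim_to_top 1 (opunit substitution_operad) = opunit (End_operad (Arr C))"
    by (auto simp: lim_to_top_def substitution_operad_def End_operad_def)
next
  fix n m k :: nat and K L
  assume A: "n \<ge> 1" "m \<ge> 1" "k \<in> {1..n}"
    and "K \<in> ops substitution_operad n" "L \<in> ops substitution_operad m"
  then have KL: "K \<in> scpx n" "L \<in> scpx m" by (auto simp: substitution_operad_def)
  show "lim_to_top (n + m - 1) (pcomp substitution_operad n m k K L) =
      pcomp (End_operad (Arr C)) n m k (lim_to_top n K) (lim_to_top m L)"
  proof (rule extensionalityI[of _ "{1..n + m - 1} \<rightarrow>\<^sub>E Arr C"])
    fix x assume x: "x \<in> {1..n + m - 1} \<rightarrow>\<^sub>E Arr C"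
    show "lim_to_top (n + m - 1) (pcomp substitution_operad n m k K L) x =
        pcomp (End_operad (Arr C)) n m k (lim_to_top n K) (lim_to_top m L) x"
      using lim_to_top_comp[OF A KL x] x
      by (simp add: substitution_operad_def End_operad_def contract_def block_def)
  qed (auto simp: lim_to_top_def End_operad_def)
next
  fix n :: nat and \<sigma> K
  assume \<sigma>: "\<sigma> permutes {1..n}"
  show "lim_to_top n (act substitution_operad n \<sigma> K) = act (End_operad (Arr C)) n \<sigma> (lim_to_top n K)"
  proof (rule extensionalityI[of _ "{1..n} \<rightarrow>\<^sub>E Arr C"])
    fix f assume f: "f \<in> {1..n} \<rightarrow>\<^sub>E Arr C"
    show "lim_to_top n (act substitution_operad n \<sigma> K) f =
        act (End_operad (Arr C)) n \<sigma> (lim_to_top n K) f"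
      using lim_to_top_permute[OF \<sigma> f] f by (simp add: substitution_operad_def End_operad_def)
  qed (auto simp: lim_to_top_def End_operad_def)
qed

lemma composition_algebra: "operad_algebra composition_operad (Arr C) bot_to_lim"
  unfolding operad_algebra_def operad_morphism_def
proof (intro conjI allI impI ballI)
  fix n K assume "K \<in> ops composition_operad n"
  then have K: "K \<in> scpx n" by (simp add: composition_operad_def)
  show "bot_to_lim n K \<in> ops (End_operad (Arr C)) n"
    using bot_to_lim(1)[OF K] by (auto simp: End_operad_def bot_to_lim_def)
next
  show "bot_to_lim 1 (opunit composition_operad) = opunit (End_operad (Arr C))"
    by (auto simp: bot_to_lim_def composition_operad_def End_operad_def)
next
  fix n m k :: nat and K L
  assume A: "n \<ge> 1" "m \<ge> 1" "k \<in> {1..n}"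
    and "K \<in> ops composition_operad n" "L \<in> ops composition_operad m"
  then have KL: "K \<in> scpx n" "L \<in> scpx m" by (auto simp: composition_operad_def)
  show "bot_to_lim (n + m - 1) (pcomp composition_operad n m k K L) =
      pcomp (End_operad (Arr C)) n m k (bot_to_lim n K) (bot_to_lim m L)"
  proof (rule extensionalityI[of _ "{1..n + m - 1} \<rightarrow>\<^sub>E Arr C"])
    fix x assume x: "x \<in> {1..n + m - 1} \<rightarrow>\<^sub>E Arr C"
    show "bot_to_lim (n + m - 1) (pcomp composition_operad n m k K L) x =
        pcomp (End_operad (Arr C)) n m k (bot_to_lim n K) (bot_to_lim m L) x"
      using bot_to_lim_comp[OF A KL x] x
      by (simp add: composition_operad_def End_operad_def contract_def block_def)
  qed (auto simp: bot_to_lim_def End_operad_def)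
next
  fix n :: nat and \<sigma> K
  assume \<sigma>: "\<sigma> permutes {1..n}"
  show "bot_to_lim n (act composition_operad n \<sigma> K) = act (End_operad (Arr C)) n \<sigma> (bot_to_lim n K)"
  proof (rule extensionalityI[of _ "{1..n} \<rightarrow>\<^sub>E Arr C"])
    fix f assume f: "f \<in> {1..n} \<rightarrow>\<^sub>E Arr C"
    show "bot_to_lim n (act composition_operad n \<sigma> K) f =
        act (End_operad (Arr C)) n \<sigma> (bot_to_lim n K) f"
      using bot_to_lim_permute[OF \<sigma> f] f by (simp add: composition_operad_def End_operad_def)
  qed (auto simp: bot_to_lim_def End_operad_def)
qed

end

theorem theorem3p29:
  fixes C :: "('o, 'm) smc"
  assumes "symmetric_monoidal_category C"
    and "strict C"
    and "complete C"
    and "continuous C"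
  shows
    "(\<exists>\<L> :: nat \<Rightarrow> nat set set \<Rightarrow> (nat \<Rightarrow> 'm) \<Rightarrow> 'm.
        (\<forall>n\<ge>1. \<forall>K\<in>scpx n. \<forall>f \<in> {1..n} \<rightarrow>\<^sub>E Arr C. is_lim_to_top C n K f (\<L> n K f)) \<and>
        operad_algebra substitution_operad (Arr C) \<L>) \<and>
     (\<exists>\<L>\<^sub>c :: nat \<Rightarrow> nat set set \<Rightarrow> (nat \<Rightarrow> 'm) \<Rightarrow> 'm.
        (\<forall>n\<ge>1. \<forall>K\<in>scpx n. \<forall>f \<in> {1..n} \<rightarrow>\<^sub>E Arr C. is_bot_to_lim C n K f (\<L>\<^sub>c n K f)) \<and>
        operad_algebra composition_operad (Arr C) \<L>\<^sub>c)"
proof -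
  interpret complete_strict_smc C by unfold_locales (fact assms)+
  have "is_lim_to_top C n K f (lim_to_top n K f)" "is_bot_to_lim C n K f (bot_to_lim n K f)"
    if K: "K \<in> scpx n" and f: "f \<in> {1..n} \<rightarrow>\<^sub>E Arr C" for n K f
  proof -
    have f': "f \<in> {1..n} \<rightarrow> Arr C" using f by blast
    note top = lim_to_top[OF K f] and bot = bot_to_lim[OF K f]
    show "is_lim_to_top C n K f (lim_to_top n K f)"
      by (rule is_lim_to_topI[OF f' K top(3,1,2)])
    show "is_bot_to_lim C n K f (bot_to_lim n K f)"
      by (rule is_bot_to_limI[OF f' bot(3,1,2)])
  qed
  then show ?thesis using substitution_algebra composition_algebra by blast
qed

end
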